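(* Let $\Gamma$ be a Coxeter diagram with Coxeter group $W$, let $J\subseteq\Gamma_0$, let $\mathcal{BH}$ be the Brink--Howlett groupoid associated to $J$, and let $I,K$ be associates of $J$. Then any two standard expressions of a morphism $w\in\mathrm{Hom}_{\mathcal{BH}}(I,K)$ are related by a (finite) sequence of atomic braid relations.
   Context: $\Gamma$ is a Coxeter diagram with finite vertex set $\Gamma_0$; $W$ is its Coxeter group with simple generators $s_i$ and length function $\ell$; $V=\bigoplus_{i\in\Gamma_0}\mathbb R\alpha_i$ is the standard geometric representation, $\Phi=\Phi^+\sqcup\Phi^-$ the roots. For $I\subseteq\Gamma_0$: $I^c=\Gamma_0\setminus I$, $I+a=I\cup\{a\}$, $I-a=I\setminus\{a\}$, $W_I=\langle s_i:i\in I\rangle$, $\Phi_I=\{w\cdot\alpha_i:i\in I,w\in W_I\}$, $\Phi_I^\pm=\Phi_I\cap\Phi^\pm$. An associate of $J$ is a subset $I\subseteq\Gamma_0$ with $W_I$ conjugate to $W_J$ in $W$. The Brink--Howlett groupoid $\mathcal{BH}$ has as objects the associates of $J$, and $\mathrm{Hom}_{\mathcal{BH}}(I,K)=\{x\in W:\{\alpha_i:i\in I\}=\{x\cdot\alpha_k:k\in K\}\}$, with composition (left to right) $\mathrm{Hom}(I,K)\times\mathrm{Hom}(K,L)\to\mathrm{Hom}(I,L)$, $(x,y)\mapsto xy$. For $a\in I^c$, $[I,a]$ is the vertex set of the connected component containing $a$ of the full subgraph of $\Gamma$ on $I+a$. If $W_K$ is finite, $w_K$ is its longest element and $\iota_K:K\to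 K$ is given by $w_K\cdot\alpha_k=-\alpha_{\iota_K(k)}$. If $W_{[I,a]}$ is finite, $v_{a,I}:=w_{[I,a]-a}w_{[I,a]}$, which is a morphism $I\to I+a-\iota_{[I,a]}(a)$ in $\mathcal{BH}$ when $I$ is an associate of $J$. A standard expression of $w\in\mathrm{Hom}_{\mathcal{BH}}(I,K)$ is a decomposition $w=v_{a_1,I_1}\cdots v_{a_m,I_m}$ into composable morphisms of $\mathcal{BH}$ with $I_1=I$ and $\ell(w)=\sum_{i=1}^m\ell(v_{a_i,I_i})$. Atomic braid relations. Let $I$ be an associate of $J$ and $a\ne b$ in $I^c$ with $|\Phi_{I+a+b}\setminus\Phi_I|<\infty$. Let $v_{a,b,I}\in W_{I+a+b}$ be the inverse of the unique element $u\in W_{I+a+b}$ with $u(\Phi^+_{I+a+b}\setminus\Phi^+_I)\subseteq\Phi^-_{I+a+b}$ and $u(\Phi_I^+)\subseteq\Phi^+_{I+a+b}$. It is known (Brink--Howlett) that $v_{a,b,I}$ is a morphism of $\mathcal{BH}$ with source $I$ having exactly two standard expressions, of the same length $m$: $v_{a_1,I_1}\cdots v_{a_m,I_m}$ with $a_1=a$, $I_1=I$, and $v_{b_1,L_1}\cdots v_{b_m,L_m}$ with $b_1=b$, $L_1=I$. The relation equating these two expressions is called an atomic braid relation; applying it to an expression means replacing a consecutive subexpression equal to one of the two by the other. *)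

theory Defs
  imports Complex_Main "HOL-Algebra.Generated_Groups" "HOL-Library.Extended_Nat"
begin

section \<open>Coxeter diagrams and Coxeter groups\<close>

text \<open>The diagram is recorded by its vertex set and its Coxeter matrix; the entry \<open>\<infinity>\<close> means
  that there is no relation between the two generators.\<close>

record 'a coxeter_diagram =
  verts :: "'a set"
  cox_m :: "'a \<Rightarrow> 'a \<Rightarrow> enat"

definition is_coxeter_diagram :: "'a coxeter_diagram \<Rightarrow> bool" where
  "is_coxeter_diagram \<Gamma> \<longleftrightarrow>
     finite (verts \<Gamma>) \<and>
     (\<forall>i\<in>verts \<Gamma>. cox_m \<Gamma> i i = 1) \<and>
     (\<forall>i\<in>verts \<Gamma>. \<forall>j\<in>verts \<Gamma>. cox_m \<Gamma> i j = cox_m \<Gamma> j i) \<and>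
     (\<forall>i\<in>verts \<Gamma>. \<forall>j\<in>verts \<Gamma>. i \<noteq> j \<longrightarrow> 2 \<le> cox_m \<Gamma> i j)"

definition adjacent :: "'a coxeter_diagram \<Rightarrow> 'a \<Rightarrow> 'a \<Rightarrow> bool" where
  "adjacent \<Gamma> i j \<longleftrightarrow> i \<noteq> j \<and> 3 \<le> cox_m \<Gamma> i j"

text \<open>The Coxeter group is the group presented by the generators \<open>s\<^sub>i\<close> and the relations
  \<open>(s\<^sub>i s\<^sub>j)\<^sup>m = 1\<close>, where \<open>m = m\<^sub>i\<^sub>j < \<infinity>\<close>: words in the vertices modulo the congruence generated by
  these relations. The case \<open>i = j\<close> is \<open>s\<^sub>i\<^sup>2 = 1\<close>, so the generators are their own inverses and no
  formal inverses are needed in words.\<close>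

inductive cox_eq :: "'a coxeter_diagram \<Rightarrow> 'a list \<Rightarrow> 'a list \<Rightarrow> bool"
  for \<Gamma> :: "'a coxeter_diagram" where
  rel: "\<lbrakk>p \<in> lists (verts \<Gamma>); q \<in> lists (verts \<Gamma>); i \<in> verts \<Gamma>; j \<in> verts \<Gamma>;
         cox_m \<Gamma> i j = enat n\<rbrakk>
        \<Longrightarrow> cox_eq \<Gamma> (p @ concat (replicate n [i, j]) @ q) (p @ q)"
| refl: "p \<in> lists (verts \<Gamma>) \<Longrightarrow> cox_eq \<Gamma> p p"
| sym: "cox_eq \<Gamma> p q \<Longrightarrow> cox_eq \<Gamma> q p"
| trans: "\<lbrakk>cox_eq \<Gamma> p q; cox_eq \<Gamma> q r\<rbrakk> \<Longrightarrow> cox_eq \<Gamma> p r"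

definition cox_class :: "'a coxeter_diagram \<Rightarrow> 'a list \<Rightarrow> 'a list set" where
  "cox_class \<Gamma> p = {q. cox_eq \<Gamma> p q}"

definition cox_group :: "'a coxeter_diagram \<Rightarrow> 'a list set monoid" where
  "cox_group \<Gamma> =
     \<lparr>carrier = cox_class \<Gamma> ` lists (verts \<Gamma>),
      monoid.mult = (\<lambda>X Y. \<Union>p\<in>X. \<Union>q\<in>Y. cox_class \<Gamma> (p @ q)),
      one = cox_class \<Gamma> []\<rparr>"

definition cox_gen :: "'a coxeter_diagram \<Rightarrow> 'a \<Rightarrow> 'a list set" where
  "cox_gen \<Gamma> i = cox_class \<Gamma> [i]"

definition cox_length :: "'a coxeter_diagram \<Rightarrow> 'a list set \<Rightarrow> nat" where
  "cox_length \<Gamma> w = (LEAST n. \<exists>p\<in>w. length p = n)"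

definition parabolic :: "'a coxeter_diagram \<Rightarrow> 'a set \<Rightarrow> 'a list set set" where
  "parabolic \<Gamma> I = generate (cox_group \<Gamma>) (cox_gen \<Gamma> ` I)"


section \<open>The geometric representation and roots\<close>

text \<open>A vector \<open>\<Sum>\<^sub>i c\<^sub>i \<alpha>\<^sub>i\<close> is the coefficient function \<open>c\<close>.\<close>

definition simple_root :: "'a \<Rightarrow> 'a \<Rightarrow> real" where
  "simple_root i = (\<lambda>k. if k = i then 1 else 0)"

definition cox_form :: "'a coxeter_diagram \<Rightarrow> 'a \<Rightarrow> 'a \<Rightarrow> real" where
  "cox_form \<Gamma> i j = (case cox_m \<Gamma> i j of enat n \<Rightarrow> - cos (pi / real n) | \<infinity> \<Rightarrow> - 1)"

text \<open>\<open>s\<^sub>i \<cdot> v = v - 2 B(\<alpha>\<^sub>i, v) \<alpha>\<^sub>i\<close>, where \<open>B\<close> is the bilinear form with \<open>B(\<alpha>\<^sub>i, \<alpha>\<^sub>j)\<close> equal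
  to \<open>cox_form \<Gamma> i j\<close>.\<close>

definition gen_act :: "'a coxeter_diagram \<Rightarrow> 'a \<Rightarrow> ('a \<Rightarrow> real) \<Rightarrow> 'a \<Rightarrow> real" where
  "gen_act \<Gamma> i v = (\<lambda>k. v k - 2 * (\<Sum>j\<in>verts \<Gamma>. cox_form \<Gamma> i j * v j) * simple_root i k)"

definition word_act :: "'a coxeter_diagram \<Rightarrow> 'a list \<Rightarrow> ('a \<Rightarrow> real) \<Rightarrow> 'a \<Rightarrow> real" where
  "word_act \<Gamma> p = foldr (gen_act \<Gamma>) p"

text \<open>All words representing \<open>w\<close> act in the same way (\<open>act_cox_class\<close> below).\<close>

definition act :: "'a coxeter_diagram \<Rightarrow> 'a list set \<Rightarrow> ('a \<Rightarrow> real) \<Rightarrow> 'a \<Rightarrow> real" where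
  "act \<Gamma> w v = the_elem ((\<lambda>p. word_act \<Gamma> p v) ` w)"

definition roots :: "'a coxeter_diagram \<Rightarrow> 'a set \<Rightarrow> ('a \<Rightarrow> real) set" where
  "roots \<Gamma> I = {act \<Gamma> w (simple_root i) | w i. w \<in> parabolic \<Gamma> I \<and> i \<in> I}"

definition pos_roots :: "'a coxeter_diagram \<Rightarrow> 'a set \<Rightarrow> ('a \<Rightarrow> real) set" where
  "pos_roots \<Gamma> I = {\<beta> \<in> roots \<Gamma> I. \<forall>k. 0 \<le> \<beta> k}"

definition neg_roots :: "'a coxeter_diagram \<Rightarrow> 'a set \<Rightarrow> ('a \<Rightarrow> real) set" where
  "neg_roots \<Gamma> I = {\<beta> \<in> roots \<Gamma> I. \<forall>k. \<beta> k \<le> 0}"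


section \<open>The Brink--Howlett groupoid\<close>

definition associates :: "'a coxeter_diagram \<Rightarrow> 'a set \<Rightarrow> 'a set set" where
  "associates \<Gamma> J = {I. I \<subseteq> verts \<Gamma> \<and>
     (\<exists>g\<in>carrier (cox_group \<Gamma>).
        parabolic \<Gamma> I =
          (\<lambda>h. g \<otimes>\<^bsub>cox_group \<Gamma>\<^esub> h \<otimes>\<^bsub>cox_group \<Gamma>\<^esub> inv\<^bsub>cox_group \<Gamma>\<^esub> g) ` parabolic \<Gamma> J)}"

text \<open>\<open>bh_hom \<Gamma> J I K\<close> is \<open>Hom(I, K)\<close> in the groupoid attached to \<open>J\<close>; composition, written left to
  right, is multiplication in the Coxeter group.\<close>

definition bh_hom :: "'a coxeter_diagram \<Rightarrow> 'a set \<Rightarrow> 'a set \<Rightarrow> 'a set \<Rightarrow> 'a list set set" where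
  "bh_hom \<Gamma> J I K = {x \<in> carrier (cox_group \<Gamma>).
     I \<in> associates \<Gamma> J \<and> K \<in> associates \<Gamma> J \<and>
     simple_root ` I = (\<lambda>k. act \<Gamma> x (simple_root k)) ` K}"

text \<open>\<open>component \<Gamma> I a\<close> is \<open>[I, a]\<close>.\<close>

definition component :: "'a coxeter_diagram \<Rightarrow> 'a set \<Rightarrow> 'a \<Rightarrow> 'a set" where
  "component \<Gamma> I a =
     {k. (a, k) \<in> {(i, j). i \<in> insert a I \<and> j \<in> insert a I \<and> adjacent \<Gamma> i j}\<^sup>*}"

definition longest :: "'a coxeter_diagram \<Rightarrow> 'a set \<Rightarrow> 'a list set" where
  "longest \<Gamma> K = (THE w. w \<in> parabolic \<Gamma> K \<and>
     (\<forall>u\<in>parabolic \<Gamma> K. cox_length \<Gamma> u \<le> cox_length \<Gamma> w))"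

definition opposition :: "'a coxeter_diagram \<Rightarrow> 'a set \<Rightarrow> 'a \<Rightarrow> 'a" where
  "opposition \<Gamma> K k =
     (THE j. j \<in> K \<and> act \<Gamma> (longest \<Gamma> K) (simple_root k) = (\<lambda>i. - simple_root j i))"

definition bh_v :: "'a coxeter_diagram \<Rightarrow> 'a \<Rightarrow> 'a set \<Rightarrow> 'a list set" where
  "bh_v \<Gamma> a I =
     longest \<Gamma> (component \<Gamma> I a - {a}) \<otimes>\<^bsub>cox_group \<Gamma>\<^esub> longest \<Gamma> (component \<Gamma> I a)"

definition bh_v_target :: "'a coxeter_diagram \<Rightarrow> 'a \<Rightarrow> 'a set \<Rightarrow> 'a set" where
  "bh_v_target \<Gamma> a I = insert a I - {opposition \<Gamma> (component \<Gamma> I a) a}"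

text \<open>The list \<open>[(a\<^sub>1, I\<^sub>1), \<dots>, (a\<^sub>m, I\<^sub>m)]\<close> stands for the expression with factors \<open>v\<close> attached to
  \<open>a\<^sub>r\<close> and \<open>I\<^sub>r\<close>. The empty list is an expression of the identity of any object.\<close>

inductive bh_path ::
  "'a coxeter_diagram \<Rightarrow> 'a set \<Rightarrow> 'a set \<Rightarrow> ('a \<times> 'a set) list \<Rightarrow> 'a set \<Rightarrow> bool"
  for \<Gamma> :: "'a coxeter_diagram" and J :: "'a set" where
  Nil: "I \<in> associates \<Gamma> J \<Longrightarrow> bh_path \<Gamma> J I [] I"
| Cons: "\<lbrakk>I \<in> associates \<Gamma> J; a \<in> verts \<Gamma> - I; finite (parabolic \<Gamma> (component \<Gamma> I a));
          bh_v \<Gamma> a I \<in> bh_hom \<Gamma> J I (bh_v_target \<Gamma> a I);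
          bh_path \<Gamma> J (bh_v_target \<Gamma> a I) e K\<rbrakk>
         \<Longrightarrow> bh_path \<Gamma> J I ((a, I) # e) K"

definition bh_prod :: "'a coxeter_diagram \<Rightarrow> ('a \<times> 'a set) list \<Rightarrow> 'a list set" where
  "bh_prod \<Gamma> e =
     foldr (\<lambda>(a, I) x. bh_v \<Gamma> a I \<otimes>\<^bsub>cox_group \<Gamma>\<^esub> x) e \<one>\<^bsub>cox_group \<Gamma>\<^esub>"

definition standard_expression ::
  "'a coxeter_diagram \<Rightarrow> 'a set \<Rightarrow> 'a set \<Rightarrow> 'a set \<Rightarrow> 'a list set \<Rightarrow> ('a \<times> 'a set) list \<Rightarrow> bool"
where
  "standard_expression \<Gamma> J I K w e \<longleftrightarrow>
     w \<in> bh_hom \<Gamma> J I K \<and> bh_path \<Gamma> J I e K \<and> w = bh_prod \<Gamma> e \<and>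
     cox_length \<Gamma> w = (\<Sum>(a, L)\<leftarrow>e. cox_length \<Gamma> (bh_v \<Gamma> a L))"


section \<open>Atomic braid relations\<close>

definition bh_vv :: "'a coxeter_diagram \<Rightarrow> 'a \<Rightarrow> 'a \<Rightarrow> 'a set \<Rightarrow> 'a list set" where
  "bh_vv \<Gamma> a b I = (let M = insert a (insert b I) in
     inv\<^bsub>cox_group \<Gamma>\<^esub> (THE u. u \<in> parabolic \<Gamma> M \<and>
        act \<Gamma> u ` (pos_roots \<Gamma> M - pos_roots \<Gamma> I) \<subseteq> neg_roots \<Gamma> M \<and>
        act \<Gamma> u ` pos_roots \<Gamma> I \<subseteq> pos_roots \<Gamma> M))"

text \<open>\<open>r\<close> and \<open>r'\<close> are the standard expressions of \<open>v\<close> attached to \<open>a\<close>, \<open>b\<close>, \<open>I\<close> that begin with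
  \<open>a\<close> and with \<open>b\<close>, respectively. Since \<open>v\<close> has exactly two standard expressions, this determines
  \<open>r\<close> and \<open>r'\<close>.\<close>

definition atomic_braid_relation ::
  "'a coxeter_diagram \<Rightarrow> 'a set \<Rightarrow> ('a \<times> 'a set) list \<Rightarrow> ('a \<times> 'a set) list \<Rightarrow> bool"
where
  "atomic_braid_relation \<Gamma> J r r' \<longleftrightarrow>
     (\<exists>I a b K f f'. I \<in> associates \<Gamma> J \<and> a \<in> verts \<Gamma> - I \<and> b \<in> verts \<Gamma> - I \<and> a \<noteq> b \<and>
        finite (roots \<Gamma> (insert a (insert b I)) - roots \<Gamma> I) \<and>
        r = (a, I) # f \<and> standard_expression \<Gamma> J I K (bh_vv \<Gamma> a b I) r \<and>
        r' = (b, I) # f' \<and> standard_expression \<Gamma> J I K (bh_vv \<Gamma> a b I) r')"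

text \<open>Either side may be replaced by the other: the relation is symmetric, since \<open>a\<close> and \<open>b\<close>
  can be exchanged.\<close>

definition atomic_braid_step ::
  "'a coxeter_diagram \<Rightarrow> 'a set \<Rightarrow> ('a \<times> 'a set) list \<Rightarrow> ('a \<times> 'a set) list \<Rightarrow> bool"
where
  "atomic_braid_step \<Gamma> J e e' \<longleftrightarrow>
     (\<exists>p q r r'. e = p @ r @ q \<and> e' = p @ r' @ q \<and> atomic_braid_relation \<Gamma> J r r')"


section \<open>Well-definedness\<close>

lemma cox_eq_lists:
  "cox_eq \<Gamma> p q \<Longrightarrow> p \<in> lists (verts \<Gamma>) \<and> q \<in> lists (verts \<Gamma>)"
  by (induction rule: cox_eq.induct) (auto split: if_splits)

lemma cox_eq_append1:
  "cox_eq \<Gamma> p q \<Longrightarrow> r \<in> lists (verts \<Gamma>) \<Longrightarrow> cox_eq \<Gamma> (r @ p) (r @ q)"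
proof (induction rule: cox_eq.induct)
  case (rel p q i j n)
  then show ?case using cox_eq.rel[of "r @ p" \<Gamma> q i j n] by simp
next
  case (sym p q)
  then show ?case by (blast intro: cox_eq.sym)
next
  case (trans p q s)
  then show ?case using cox_eq.trans by blast
next
  case (refl p)
  then show ?case by (simp add: cox_eq.refl)
qed

lemma cox_eq_append2:
  "cox_eq \<Gamma> p q \<Longrightarrow> r \<in> lists (verts \<Gamma>) \<Longrightarrow> cox_eq \<Gamma> (p @ r) (q @ r)"
proof (induction rule: cox_eq.induct)
  case (rel p q i j n)
  then show ?case using cox_eq.rel[of p \<Gamma> "q @ r" i j n] by simp
next
  case (sym p q)
  then show ?case by (blast intro: cox_eq.sym)
next
  case (trans p q s)
  then show ?case using cox_eq.trans by blast
next
  case (refl p)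
  then show ?case by (simp add: cox_eq.refl)
qed

lemma cox_class_eq: "cox_eq \<Gamma> p q \<Longrightarrow> cox_class \<Gamma> p = cox_class \<Gamma> q"
  unfolding cox_class_def using cox_eq.sym cox_eq.trans by blast

lemma cox_mult_class:
  assumes "p \<in> lists (verts \<Gamma>)" "q \<in> lists (verts \<Gamma>)"
  shows "cox_class \<Gamma> p \<otimes>\<^bsub>cox_group \<Gamma>\<^esub> cox_class \<Gamma> q = cox_class \<Gamma> (p @ q)"
proof -
  have "cox_class \<Gamma> (p' @ q') = cox_class \<Gamma> (p @ q)"
    if "cox_eq \<Gamma> p p'" "cox_eq \<Gamma> q q'" for p' q'
  proof -
    have "cox_eq \<Gamma> (p @ q) (p' @ q)" using that assms by (intro cox_eq_append2)
    moreover have "cox_eq \<Gamma> (p' @ q) (p' @ q')"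
      using that cox_eq_lists[of \<Gamma> p p'] by (intro cox_eq_append1) auto
    ultimately show ?thesis by (metis cox_class_eq)
  qed
  moreover have "cox_eq \<Gamma> p p" "cox_eq \<Gamma> q q"
    using assms by (auto intro: cox_eq.refl)
  ultimately have "(\<Union>p'\<in>{x. cox_eq \<Gamma> p x}. \<Union>q'\<in>{x. cox_eq \<Gamma> q x}. cox_class \<Gamma> (p' @ q')) =
      cox_class \<Gamma> (p @ q)"
    by blast
  then show ?thesis
    by (simp add: cox_group_def cox_class_def[of \<Gamma> p] cox_class_def[of \<Gamma> q])
qed

lemma cox_rev:
  assumes "is_coxeter_diagram \<Gamma>" "p \<in> lists (verts \<Gamma>)"
  shows "cox_eq \<Gamma> (rev p @ p) []"
  using assms(2)
proof (induction p)
  case Nil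
  then show ?case by (auto intro: cox_eq.refl)
next
  case (Cons i p)
  have "cox_m \<Gamma> i i = enat 1"
    using Cons assms(1) by (auto simp: is_coxeter_diagram_def one_enat_def)
  then have "cox_eq \<Gamma> (rev p @ concat (replicate 1 [i, i]) @ p) (rev p @ p)"
    using Cons by (intro cox_eq.rel) auto
  moreover have "cox_eq \<Gamma> (rev p @ p) []" using Cons by blast
  ultimately show ?case using cox_eq.trans by fastforce
qed

lemma group_cox_group:
  assumes "is_coxeter_diagram \<Gamma>"
  shows "group (cox_group \<Gamma>)"
proof -
  have carr: "carrier (cox_group \<Gamma>) = cox_class \<Gamma> ` lists (verts \<Gamma>)"
    and one: "\<one>\<^bsub>cox_group \<Gamma>\<^esub> = cox_class \<Gamma> []"
    by (simp_all add: cox_group_def)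
  show ?thesis
  proof (rule groupI)
    fix x assume "x \<in> carrier (cox_group \<Gamma>)"
    then obtain p where p: "p \<in> lists (verts \<Gamma>)" "x = cox_class \<Gamma> p" by (auto simp only: carr)
    have r: "rev p \<in> lists (verts \<Gamma>)" using p(1) by auto
    have "cox_class \<Gamma> (rev p) \<otimes>\<^bsub>cox_group \<Gamma>\<^esub> x = \<one>\<^bsub>cox_group \<Gamma>\<^esub>"
      unfolding p(2) one cox_mult_class[OF r p(1)] using cox_class_eq[OF cox_rev[OF assms p(1)]] .
    then show "\<exists>y\<in>carrier (cox_group \<Gamma>). y \<otimes>\<^bsub>cox_group \<Gamma>\<^esub> x = \<one>\<^bsub>cox_group \<Gamma>\<^esub>"
      using r unfolding carr by blast
  next
    fix x y assume "x \<in> carrier (cox_group \<Gamma>)" "y \<in> carrier (cox_group \<Gamma>)"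
    then obtain p q where pq: "p \<in> lists (verts \<Gamma>)" "q \<in> lists (verts \<Gamma>)"
      "x = cox_class \<Gamma> p" "y = cox_class \<Gamma> q" by (auto simp only: carr)
    then show "x \<otimes>\<^bsub>cox_group \<Gamma>\<^esub> y \<in> carrier (cox_group \<Gamma>)"
      unfolding pq(3,4) cox_mult_class[OF pq(1,2)] carr by (intro imageI) auto
  next
    fix x y z
    assume "x \<in> carrier (cox_group \<Gamma>)" "y \<in> carrier (cox_group \<Gamma>)" "z \<in> carrier (cox_group \<Gamma>)"
    then obtain p q r where pqr: "p \<in> lists (verts \<Gamma>)" "q \<in> lists (verts \<Gamma>)"
      "r \<in> lists (verts \<Gamma>)" "x = cox_class \<Gamma> p" "y = cox_class \<Gamma> q" "z = cox_class \<Gamma> r"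
      by (auto simp only: carr)
    then have "p @ q \<in> lists (verts \<Gamma>)" "q @ r \<in> lists (verts \<Gamma>)" by auto
    with pqr show "x \<otimes>\<^bsub>cox_group \<Gamma>\<^esub> y \<otimes>\<^bsub>cox_group \<Gamma>\<^esub> z =
        x \<otimes>\<^bsub>cox_group \<Gamma>\<^esub> (y \<otimes>\<^bsub>cox_group \<Gamma>\<^esub> z)"
      by (simp only: cox_mult_class append_assoc)
  next
    fix x assume "x \<in> carrier (cox_group \<Gamma>)"
    then obtain p where "p \<in> lists (verts \<Gamma>)" "x = cox_class \<Gamma> p" by (auto simp only: carr)
    then show "\<one>\<^bsub>cox_group \<Gamma>\<^esub> \<otimes>\<^bsub>cox_group \<Gamma>\<^esub> x = x"
      by (simp only: one cox_mult_class lists.Nil append_Nil)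
  qed (simp add: carr one)
qed

lemma braid_rotation:
  fixes P Q :: "nat \<Rightarrow> real" and \<theta> :: real
  assumes "\<And>k. Q (Suc k) = 2 * cos \<theta> * P k - Q k"
    and "\<And>k. P (Suc k) = 2 * cos \<theta> * Q (Suc k) - P k"
  shows "sin \<theta> * P k = P 0 * sin ((2 * real k + 1) * \<theta>) - Q 0 * sin (2 * real k * \<theta>) \<and>
         sin \<theta> * Q k = P 0 * sin (2 * real k * \<theta>) - Q 0 * sin ((2 * real k - 1) * \<theta>)"
proof (induction k)
  case 0
  show ?case by simp
next
  case (Suc k)
  have rec: "sin (x + \<theta>) = 2 * cos \<theta> * sin x - sin (x - \<theta>)" for x
    by (simp add: sin_add sin_diff)
  have 1: "sin (2 * real (Suc k) * \<theta>) = 2 * cos \<theta> * sin ((2 * real k + 1) * \<theta>) - sin (2 * real k * \<theta>)"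
    using rec[of "(2 * real k + 1) * \<theta>"] by (simp add: algebra_simps)
  have 2: "sin ((2 * real (Suc k) - 1) * \<theta>) = 2 * cos \<theta> * sin (2 * real k * \<theta>) - sin ((2 * real k - 1) * \<theta>)"
    using rec[of "2 * real k * \<theta>"] by (simp add: algebra_simps)
  have 3: "sin ((2 * real (Suc k) + 1) * \<theta>) = 2 * cos \<theta> * sin (2 * real (Suc k) * \<theta>) - sin ((2 * real k + 1) * \<theta>)"
    using rec[of "2 * real (Suc k) * \<theta>"] by (simp add: algebra_simps)
  have 4: "(2 * real (Suc k) - 1) * \<theta> = (2 * real k + 1) * \<theta>" by simp
  have Q: "sin \<theta> * Q (Suc k) = P 0 * sin (2 * real (Suc k) * \<theta>) - Q 0 * sin ((2 * real (Suc k) - 1) * \<theta>)"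
  proof -
    have "sin \<theta> * Q (Suc k) = 2 * cos \<theta> * (sin \<theta> * P k) - sin \<theta> * Q k"
      by (simp add: assms(1) algebra_simps)
    then show ?thesis unfolding 1 2 conjunct1[OF Suc] conjunct2[OF Suc] by argo
  qed
  have "sin \<theta> * P (Suc k) = 2 * cos \<theta> * (sin \<theta> * Q (Suc k)) - sin \<theta> * P k"
    by (simp add: assms(2) algebra_simps)
  then have P: "sin \<theta> * P (Suc k) = P 0 * sin ((2 * real (Suc k) + 1) * \<theta>) - Q 0 * sin (2 * real (Suc k) * \<theta>)"
    unfolding 3 Q 4 conjunct1[OF Suc] using arg_cong[OF 1, of "(*) (Q 0)"] by argo
  from P Q show ?case by simp
qed

lemma word_act_append: "word_act \<Gamma> (p @ q) v = word_act \<Gamma> p (word_act \<Gamma> q v)"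
  by (simp add: word_act_def)

lemma form_simple_root:
  assumes "is_coxeter_diagram \<Gamma>" "j \<in> verts \<Gamma>"
  shows "(\<Sum>l\<in>verts \<Gamma>. cox_form \<Gamma> i l * (v l + c * simple_root j l)) =
         (\<Sum>l\<in>verts \<Gamma>. cox_form \<Gamma> i l * v l) + c * cox_form \<Gamma> i j"
proof -
  have "(\<Sum>l\<in>verts \<Gamma>. cox_form \<Gamma> i l * (c * simple_root j l)) =
        (\<Sum>l\<in>verts \<Gamma>. if l = j then c * cox_form \<Gamma> i j else 0)"
    by (intro sum.cong) (auto simp: simple_root_def)
  also have "\<dots> = c * cox_form \<Gamma> i j"
    using assms by (subst sum.delta) (auto simp: is_coxeter_diagram_def)
  finally show ?thesis by (simp add: distrib_left sum.distrib)
qed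

lemma word_act_relation:
  assumes \<Gamma>: "is_coxeter_diagram \<Gamma>" and i: "i \<in> verts \<Gamma>" and j: "j \<in> verts \<Gamma>"
    and m: "cox_m \<Gamma> i j = enat n"
  shows "word_act \<Gamma> (concat (replicate n [i, j])) v = v"
proof -
  define B where "B = (\<lambda>k v. \<Sum>l\<in>verts \<Gamma>. cox_form \<Gamma> k l * v l)"
  have act: "gen_act \<Gamma> k v = (\<lambda>l. v l + (- 2 * B k v) * simple_root k l)" for k v
    by (auto simp: gen_act_def B_def)
  have B_add: "B k (\<lambda>l. v l + c * simple_root i l) = B k v + c * cox_form \<Gamma> k i"
    "B k (\<lambda>l. v l + c * simple_root j l) = B k v + c * cox_form \<Gamma> k j" for k v c
    unfolding B_def using form_simple_root[OF \<Gamma>] i j by auto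
  have diag: "cox_form \<Gamma> k k = 1" if "k \<in> verts \<Gamma>" for k
    using that \<Gamma> by (auto simp: cox_form_def is_coxeter_diagram_def one_enat_def)
  show ?thesis
  proof (cases "i = j")
    case True
    then have "n = 1" using m i \<Gamma> by (auto simp: is_coxeter_diagram_def one_enat_def)
    moreover have "gen_act \<Gamma> i (gen_act \<Gamma> i v) = v"
      unfolding act B_add diag[OF i] by (auto simp: algebra_simps)
    ultimately show ?thesis using True by (simp add: word_act_def)
  next
    case False
    then have n: "2 \<le> n"
    proof -
      have "(2 :: enat) \<le> enat n"
        using m i j False \<Gamma> unfolding is_coxeter_diagram_def by metis
      then show ?thesis by (simp add: numeral_eq_enat)
    qed
    define \<theta> where "\<theta> = pi / real n"
    have sin: "sin \<theta> > 0"
      using n by (intro sin_gt_zero) (auto simp: \<theta>_def field_simps)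
    have "cox_m \<Gamma> j i = enat n"
      using m i j \<Gamma> by (metis is_coxeter_diagram_def)
    then have form: "cox_form \<Gamma> i j = - cos \<theta>" "cox_form \<Gamma> j i = - cos \<theta>"
      using m by (auto simp: cox_form_def \<theta>_def)
    define P0 where "P0 = (B i v + cos \<theta> * B j v) / (sin \<theta>)\<^sup>2"
    define Q0 where "Q0 = (B j v + cos \<theta> * B i v) / (sin \<theta>)\<^sup>2"
    have "B i v = P0 - cos \<theta> * Q0" "B j v = Q0 - cos \<theta> * P0"
    proof -
      have c: "1 - (cos \<theta>)\<^sup>2 = (sin \<theta>)\<^sup>2" by (simp add: sin_squared_eq)
      have "P0 - cos \<theta> * Q0 = B i v * (1 - (cos \<theta>)\<^sup>2) / (sin \<theta>)\<^sup>2"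
        "Q0 - cos \<theta> * P0 = B j v * (1 - (cos \<theta>)\<^sup>2) / (sin \<theta>)\<^sup>2"
        by (simp_all add: P0_def Q0_def diff_divide_distrib[symmetric] algebra_simps power2_eq_square)
      then show "B i v = P0 - cos \<theta> * Q0" "B j v = Q0 - cos \<theta> * P0"
        unfolding c using sin by auto
    qed
    note B0 = this
    define PQ where "PQ = rec_nat (P0, Q0) (\<lambda>_ (P, Q).
      (2 * cos \<theta> * (2 * cos \<theta> * P - Q) - P, 2 * cos \<theta> * P - Q))"
    define P where "P k = fst (PQ k)" for k
    define Q where "Q k = snd (PQ k)" for k
    have PQ0: "P 0 = P0" "Q 0 = Q0" by (simp_all add: P_def Q_def PQ_def)
    have QS: "Q (Suc k) = 2 * cos \<theta> * P k - Q k" for k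
      by (simp add: P_def Q_def PQ_def split: prod.split)
    have PS: "P (Suc k) = 2 * cos \<theta> * Q (Suc k) - P k" for k
      by (simp add: P_def Q_def PQ_def split: prod.split)
    have step: "word_act \<Gamma> (concat (replicate k [i, j])) v =
      (\<lambda>l. v l + (P k - P0) * simple_root i l + (Q k - Q0) * simple_root j l)" for k
    proof (induction k)
      case 0
      show ?case by (simp add: word_act_def PQ0)
    next
      case (Suc k)
      have "word_act \<Gamma> (concat (replicate (Suc k) [i, j])) v =
        gen_act \<Gamma> i (gen_act \<Gamma> j (word_act \<Gamma> (concat (replicate k [i, j])) v))"
        by (simp add: word_act_def)
      then show ?case
        unfolding Suc act B_add form diag[OF i] diag[OF j] B0 PS QS
        by (auto simp: algebra_simps)
    qed
    have "sin ((2 * real n + 1) * \<theta>) = sin \<theta>" "sin (2 * real n * \<theta>) = 0"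
      "sin ((2 * real n - 1) * \<theta>) = - sin \<theta>"
    proof -
      have "2 * real n * \<theta> = 2 * pi" using n by (simp add: \<theta>_def)
      then have "(2 * real n + 1) * \<theta> = \<theta> + 2 * pi" "(2 * real n - 1) * \<theta> = 2 * pi - \<theta>"
        and *: "2 * real n * \<theta> = 2 * pi"
        by (simp_all add: algebra_simps)
      then show "sin ((2 * real n + 1) * \<theta>) = sin \<theta>" "sin (2 * real n * \<theta>) = 0"
        "sin ((2 * real n - 1) * \<theta>) = - sin \<theta>"
        by (simp_all only: sin_periodic sin_2pi_minus sin_two_pi)
    qed
    then have "sin \<theta> * P n = P0 * sin \<theta>" "sin \<theta> * Q n = Q0 * sin \<theta>"
      using braid_rotation[of Q \<theta> P n, OF QS PS] by (simp_all add: PQ0)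
    then have "P n = P0" "Q n = Q0" using sin by auto
    then show ?thesis using step[of n] by simp
  qed
qed

lemma word_act_cong:
  assumes "cox_eq \<Gamma> p q" "is_coxeter_diagram \<Gamma>"
  shows "word_act \<Gamma> p v = word_act \<Gamma> q v"
  using assms(1) by induction (simp_all add: word_act_append word_act_relation[OF assms(2)])

lemma act_cox_class:
  assumes "is_coxeter_diagram \<Gamma>" "p \<in> lists (verts \<Gamma>)"
  shows "act \<Gamma> (cox_class \<Gamma> p) v = word_act \<Gamma> p v"
proof -
  have "(\<lambda>q. word_act \<Gamma> q v) ` cox_class \<Gamma> p = {word_act \<Gamma> p v}"
  proof
    show "(\<lambda>q. word_act \<Gamma> q v) ` cox_class \<Gamma> p \<subseteq> {word_act \<Gamma> p v}"
    proof
      fix u assume "u \<in> (\<lambda>q. word_act \<Gamma> q v) ` cox_class \<Gamma> p"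
      then obtain q where "cox_eq \<Gamma> p q" "u = word_act \<Gamma> q v"
        unfolding cox_class_def by blast
      with word_act_cong[OF this(1) assms(1)] show "u \<in> {word_act \<Gamma> p v}" by simp
    qed
    show "{word_act \<Gamma> p v} \<subseteq> (\<lambda>q. word_act \<Gamma> q v) ` cox_class \<Gamma> p"
      using cox_eq.refl[OF assms(2)] unfolding cox_class_def by blast
  qed
  then show ?thesis by (simp add: act_def)
qed

end

theory Submission
  imports Defs
begin

text \<open>The argument follows the proof of Matsumoto's theorem. If two standard expressions of
  \<open>w \<in> Hom(I, K)\<close> begin with \<open>v\<^bsub>a,I\<^esub>\<close> and \<open>v\<^bsub>b,I\<^esub>\<close>, \<open>a \<noteq> b\<close>, then \<open>w\<^sup>-\<^sup>1\<close> maps \<open>\<alpha>\<^sub>a\<close> and \<open>\<alpha>\<^sub>b\<close> to negative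
  roots and the simple roots of \<open>I\<close> to simple roots, so it makes every positive root of \<open>\<Phi>\<^bsub>I+a+b\<^esub>\<close> outside
  \<open>\<Phi>\<^sub>I\<close> negative. Hence the \<open>W\<^bsub>I+a+b\<^esub>\<close>-part of \<open>w\<close> is \<open>v\<^bsub>a,b,I\<^esub>\<close>, a length-additive left factor of \<open>w\<close>. Every
  morphism has a standard expression, and its first factor can be chosen at any left descent, so \<open>w\<close>
  has two standard expressions that differ by one atomic braid relation at their left ends and
  begin with \<open>v\<^bsub>a,I\<^esub>\<close> and \<open>v\<^bsub>b,I\<^esub>\<close>. Induction on the length of \<open>w\<close> connects them to the given ones.\<close>

text \<open>Questions about length are therefore moved to signs of roots: right multiplication by
  \<open>s i\<close> shortens \<open>x\<close> exactly when \<open>x \<bullet> \<alpha> i\<close> is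
  nonpositive. Finiteness is extracted from the morphism itself. An element makes only finitely many
  positive roots negative; if \<open>ginv w\<close> negates \<open>\<alpha> a\<close>, these include
  all positive roots of \<open>[I, a]\<close> with nonzero \<open>a\<close>-coordinate, and
  connectedness then makes the parabolic subgroup of \<open>[I, a]\<close> finite. The same count
  gives the finiteness condition in the atomic braid relation. Behind everything is the fact that a
  root has coefficients of one sign. It reduces to rank two, where the coefficients are
  \<open>sin (k * \<theta>) / sin \<theta>\<close> with \<open>\<theta> = pi / m\<close>. Chebyshev
  polynomials express them through \<open>c = cos \<theta>\<close> alone, so that the label infinity
  is the value \<open>c = 1\<close>.\<close>

text \<open>\<open>cheb c k\<close> is the Chebyshev polynomial \<open>U\<^bsub>k-1\<^esub>(c)\<close>; the indices are shifted by one.\<close>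

fun cheb :: "real \<Rightarrow> nat \<Rightarrow> real" where
  "cheb c 0 = 0"
| "cheb c (Suc 0) = 1"
| "cheb c (Suc (Suc k)) = 2 * c * cheb c (Suc k) - cheb c k"

lemma cheb_cos: "cheb (cos \<theta>) k * sin \<theta> = sin (real k * \<theta>)"
proof (induction "cos \<theta>" k rule: cheb.induct)
  case (3 k)
  have "sin (real (Suc (Suc k)) * \<theta>) = sin (real (Suc k) * \<theta> + \<theta>)" by (simp add: algebra_simps)
  moreover have "sin (real k * \<theta>) = sin (real (Suc k) * \<theta> - \<theta>)" by (simp add: algebra_simps)
  moreover have "sin (x + \<theta>) = 2 * cos \<theta> * sin x - sin (x - \<theta>)" for x
    by (simp add: sin_add sin_diff)
  ultimately have *: "sin (real (Suc (Suc k)) * \<theta>) = 2 * cos \<theta> * sin (real (Suc k) * \<theta>) - sin (real k * \<theta>)"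
    by metis
  show ?case unfolding * 3[symmetric] by (simp add: algebra_simps)
qed auto

text \<open>This is the value of \<open>c\<close> for the label infinity, where
  \<open>cheb_cos\<close> with \<open>\<theta> = 0\<close> says only \<open>0 = 0\<close>.\<close>

lemma cheb_1: "cheb 1 k = real k"
  by (induction "1::real" k rule: cheb.induct) auto

text \<open>Words grow at the left, so a nonempty one always ends in \<open>j\<close>. The last
  letter acts first on a vector, hence the recursion follows its successive images.\<close>

fun alt :: "'a \<Rightarrow> 'a \<Rightarrow> nat \<Rightarrow> 'a list" where
  "alt i j 0 = []"
| "alt i j (Suc k) = (if even k then j else i) # alt i j k"

lemma alt_lists: "i \<in> A \<Longrightarrow> j \<in> A \<Longrightarrow> alt i j k \<in> lists A"
  by (induction k) auto

lemma length_alt [simp]: "length (alt i j k) = k"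
  by (induction k) auto

lemma alt_snoc: "alt i j k @ [i] = alt j i (Suc k)"
  by (induction k) auto

lemma alt_double: "alt i j (2 * k) = concat (replicate k [i, j])"
  by (induction k) auto

lemma alt_split: "i \<in> A \<Longrightarrow> j \<in> A \<Longrightarrow> \<exists>q\<in>lists A. length q = a \<and> alt i j (a + b) = q @ alt i j b"
proof (induction a)
  case (Suc a)
  then obtain q where q: "q \<in> lists A" "length q = a" "alt i j (a + b) = q @ alt i j b" by blast
  then show ?case using Suc(2,3)
    by (intro bexI[of _ "(if even (a + b) then j else i) # q"]) auto
qed auto

section \<open>Vectors with coefficients of one sign\<close>

definition nonneg :: "('a \<Rightarrow> real) \<Rightarrow> bool" where
  "nonneg v \<longleftrightarrow> (\<forall>k. 0 \<le> v k)"

definition nonpos :: "('a \<Rightarrow> real) \<Rightarrow> bool" where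
  "nonpos v \<longleftrightarrow> (\<forall>k. v k \<le> 0)"

lemma nonneg_minus [simp]: "nonneg (\<lambda>k. - v k) \<longleftrightarrow> nonpos v"
  by (simp add: nonneg_def nonpos_def)

lemma nonpos_minus [simp]: "nonpos (\<lambda>k. - v k) \<longleftrightarrow> nonneg v"
  by (simp add: nonneg_def nonpos_def)

lemma nonneg_simple [simp]: "nonneg (simple_root i)"
  by (simp add: nonneg_def simple_root_def)

lemma not_nonpos_simple [simp]: "\<not> nonpos (simple_root i)"
  by (auto simp: nonpos_def simple_root_def intro!: exI[of _ i])

lemma nonneg_add: "nonneg u \<Longrightarrow> nonneg v \<Longrightarrow> 0 \<le> a \<Longrightarrow> 0 \<le> b \<Longrightarrow> nonneg (\<lambda>k. a * u k + b * v k)"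
  by (simp add: nonneg_def)

lemma nonneg_sum: "(\<And>m. m \<in> M \<Longrightarrow> 0 \<le> c m \<and> nonneg (f m)) \<Longrightarrow> nonneg (\<lambda>k. \<Sum>m\<in>M. c m * f m k)"
  by (auto simp: nonneg_def intro!: sum_nonneg)

section \<open>The group of a fixed Coxeter diagram\<close>

locale coxeter =
  fixes \<Gamma> :: "'a coxeter_diagram"
  assumes diagram: "is_coxeter_diagram \<Gamma>"
begin

abbreviation "S \<equiv> verts \<Gamma>"
abbreviation "W \<equiv> carrier (cox_group \<Gamma>)"
abbreviation gmul (infixl "\<cdot>" 70) where "x \<cdot> y \<equiv> x \<otimes>\<^bsub>cox_group \<Gamma>\<^esub> y"
abbreviation "e1 \<equiv> \<one>\<^bsub>cox_group \<Gamma>\<^esub>"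
abbreviation "ginv x \<equiv> inv\<^bsub>cox_group \<Gamma>\<^esub> x"
abbreviation "s \<equiv> cox_gen \<Gamma>"
abbreviation "len \<equiv> cox_length \<Gamma>"
abbreviation "\<alpha> \<equiv> simple_root"
abbreviation act_on (infixr "\<bullet>" 75) where "x \<bullet> v \<equiv> act \<Gamma> x v"

sublocale group "cox_group \<Gamma>"
  using group_cox_group[OF diagram] .

lemma finite_S: "finite S"
  using diagram by (simp add: is_coxeter_diagram_def)

lemma finite_sub: "M \<subseteq> S \<Longrightarrow> finite M"
  using finite_S finite_subset by blast

lemma W_eq: "W = cox_class \<Gamma> ` lists S"
  by (simp add: cox_group_def)

lemma one_eq: "e1 = cox_class \<Gamma> []"
  by (simp add: cox_group_def)

lemma W_E:
  assumes "x \<in> W" obtains p where "p \<in> lists S" "x = cox_class \<Gamma> p"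
  using assms unfolding W_eq by blast

lemma class_in_W: "p \<in> lists S \<Longrightarrow> cox_class \<Gamma> p \<in> W"
  unfolding W_eq by blast

lemma s_in_W [simp]: "i \<in> S \<Longrightarrow> s i \<in> W"
  unfolding cox_gen_def by (rule class_in_W) simp

lemma class_append:
  "p \<in> lists S \<Longrightarrow> q \<in> lists S \<Longrightarrow> cox_class \<Gamma> (p @ q) = cox_class \<Gamma> p \<cdot> cox_class \<Gamma> q"
  by (simp only: cox_mult_class)

lemma class_Cons:
  "i \<in> S \<Longrightarrow> q \<in> lists S \<Longrightarrow> cox_class \<Gamma> (i # q) = s i \<cdot> cox_class \<Gamma> q"
  using class_append[of "[i]" q] by (simp add: cox_gen_def)

lemma class_snoc:
  "i \<in> S \<Longrightarrow> q \<in> lists S \<Longrightarrow> cox_class \<Gamma> (q @ [i]) = cox_class \<Gamma> q \<cdot> s i"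
  using class_append[of q "[i]"] by (simp add: cox_gen_def)

lemma inv_class: "p \<in> lists S \<Longrightarrow> ginv (cox_class \<Gamma> p) = cox_class \<Gamma> (rev p)"
proof -
  assume p: "p \<in> lists S"
  then have r: "rev p \<in> lists S" by auto
  show "ginv (cox_class \<Gamma> p) = cox_class \<Gamma> (rev p)"
    using cox_class_eq[OF cox_rev[OF diagram p]] p r
    by (intro inv_equality) (simp_all only: class_append[symmetric] one_eq class_in_W)
qed

lemma s_s [simp]: "i \<in> S \<Longrightarrow> s i \<cdot> s i = e1"
  using inv_class[of "[i]"] r_inv[of "s i"] by (simp add: cox_gen_def class_in_W)

lemma inv_s [simp]: "i \<in> S \<Longrightarrow> ginv (s i) = s i"
  by (intro inv_equality) auto

lemma mult_s_s [simp]: "x \<in> W \<Longrightarrow> i \<in> S \<Longrightarrow> x \<cdot> s i \<cdot> s i = x"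
  by (simp add: m_assoc)

lemma inv_mult: "x \<in> W \<Longrightarrow> y \<in> W \<Longrightarrow> ginv (x \<cdot> y) = ginv y \<cdot> ginv x"
  by (rule inv_mult_group)

lemma inv_cancel [simp]:
  assumes "x \<in> W" "y \<in> W"
  shows "ginv x \<cdot> (x \<cdot> y) = y" "x \<cdot> (ginv x \<cdot> y) = y" "y \<cdot> x \<cdot> ginv x = y" "y \<cdot> ginv x \<cdot> x = y"
proof -
  show "ginv x \<cdot> (x \<cdot> y) = y" "x \<cdot> (ginv x \<cdot> y) = y" using assms by (simp_all add: m_assoc[symmetric])
  show "y \<cdot> x \<cdot> ginv x = y" "y \<cdot> ginv x \<cdot> x = y" using assms by (simp_all add: m_assoc)
qed

lemma W_induct [consumes 1, case_names one snoc]: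
  assumes "x \<in> W" "P e1" "\<And>x i. x \<in> W \<Longrightarrow> i \<in> S \<Longrightarrow> P x \<Longrightarrow> P (x \<cdot> s i)"
  shows "P x"
proof -
  have "P (cox_class \<Gamma> p)" if "p \<in> lists S" for p
    using that
  proof (induction p rule: rev_induct)
    case Nil
    then show ?case using assms(2) by (simp add: one_eq)
  next
    case (snoc i p)
    then show ?case using assms(3)[of "cox_class \<Gamma> p" i] by (simp add: class_snoc class_in_W)
  qed
  then show ?thesis using assms(1) by (metis W_E)
qed


section \<open>Parabolic subgroups\<close>

lemma parabolic_class: "M \<subseteq> S \<Longrightarrow> p \<in> lists M \<Longrightarrow> cox_class \<Gamma> p \<in> parabolic \<Gamma> M"
proof (induction p)
  case Nil
  then show ?case using generate.one[of "cox_group \<Gamma>"] by (simp add: parabolic_def one_eq)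
next
  case (Cons i p)
  then have "s i \<in> parabolic \<Gamma> M" by (auto simp: parabolic_def intro: generate.incl)
  moreover have "p \<in> lists S" using Cons by auto
  ultimately show ?case using Cons generate.eng[of "s i"] by (simp add: parabolic_def class_Cons subset_iff)
qed

lemma parabolic_subgroup: "M \<subseteq> S \<Longrightarrow> subgroup (parabolic \<Gamma> M) (cox_group \<Gamma>)"
  unfolding parabolic_def by (rule generate_is_subgroup) auto

lemma parabolic_in_W: "M \<subseteq> S \<Longrightarrow> x \<in> parabolic \<Gamma> M \<Longrightarrow> x \<in> W"
  using parabolic_subgroup subgroup.mem_carrier by metis

lemma parabolic_mult:
  "M \<subseteq> S \<Longrightarrow> x \<in> parabolic \<Gamma> M \<Longrightarrow> y \<in> parabolic \<Gamma> M \<Longrightarrow> x \<cdot> y \<in> parabolic \<Gamma> M"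
  using parabolic_subgroup subgroup.m_closed by metis

lemma parabolic_inv: "M \<subseteq> S \<Longrightarrow> x \<in> parabolic \<Gamma> M \<Longrightarrow> ginv x \<in> parabolic \<Gamma> M"
  using parabolic_subgroup subgroup.m_inv_closed by metis

lemma parabolic_one: "M \<subseteq> S \<Longrightarrow> e1 \<in> parabolic \<Gamma> M"
  using parabolic_subgroup subgroup.one_closed by metis

lemma parabolic_gen: "i \<in> M \<Longrightarrow> s i \<in> parabolic \<Gamma> M"
  unfolding parabolic_def by (auto intro: generate.incl)

lemma parabolic_mono: "M \<subseteq> N \<Longrightarrow> parabolic \<Gamma> M \<subseteq> parabolic \<Gamma> N"
  unfolding parabolic_def by (intro mono_generate image_mono)

lemma parabolic_E:
  assumes "M \<subseteq> S" "x \<in> parabolic \<Gamma> M"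
  obtains p where "p \<in> lists M" "x = cox_class \<Gamma> p"
proof -
  have L: "p \<in> lists S" if "p \<in> lists M" for p using that assms(1) by auto
  have "\<exists>p\<in>lists M. x = cox_class \<Gamma> p"
    using assms(2) unfolding parabolic_def
  proof (induction rule: generate.induct)
    case one
    then show ?case using one_eq by blast
  next
    case (incl h)
    then obtain i where "i \<in> M" "h = s i" by blast
    then show ?case by (intro bexI[of _ "[i]"]) (auto simp: cox_gen_def)
  next
    case (inv h)
    then obtain i where "i \<in> M" "h = s i" by blast
    then show ?case using assms(1) by (intro bexI[of _ "[i]"]) (auto simp: cox_gen_def[symmetric] subsetD)
  next
    case (eng h1 h2)
    then obtain p q where pq: "p \<in> lists M" "q \<in> lists M" "h1 = cox_class \<Gamma> p" "h2 = cox_class \<Gamma> q"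
      by blast
    then show ?case using L by (intro bexI[of _ "p @ q"]) (auto simp: class_append)
  qed
  then show thesis using that by blast
qed

lemma parabolic_induct [consumes 2, case_names one snoc]:
  assumes "M \<subseteq> S" "x \<in> parabolic \<Gamma> M" "P e1"
    "\<And>x i. x \<in> parabolic \<Gamma> M \<Longrightarrow> i \<in> M \<Longrightarrow> P x \<Longrightarrow> P (x \<cdot> s i)"
  shows "P x"
proof -
  have "P (cox_class \<Gamma> p)" if "p \<in> lists M" for p
    using that
  proof (induction p rule: rev_induct)
    case Nil
    then show ?case using assms(3) by (simp add: one_eq)
  next
    case (snoc i p)
    then have "p \<in> lists S" "i \<in> S" using assms(1) by auto
    then show ?case using assms(1) snoc assms(4)[of "cox_class \<Gamma> p" i]
      by (simp add: class_snoc parabolic_class)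
  qed
  then show ?thesis using assms(1,2) by (metis parabolic_E)
qed


section \<open>Length\<close>

lemma mem_class: "p \<in> lists S \<Longrightarrow> p \<in> cox_class \<Gamma> p"
  by (simp add: cox_class_def cox_eq.refl)

lemma length_le: "p \<in> lists S \<Longrightarrow> len (cox_class \<Gamma> p) \<le> length p"
  unfolding cox_length_def by (rule Least_le) (use mem_class in blast)

lemma length_E:
  assumes "x \<in> W" obtains p where "p \<in> lists S" "x = cox_class \<Gamma> p" "length p = len x"
proof -
  obtain q where q: "q \<in> lists S" "x = cox_class \<Gamma> q" using assms by (rule W_E)
  have "\<exists>p\<in>x. length p = len x" unfolding cox_length_def
    by (rule LeastI_ex) (use q mem_class in blast)
  then obtain p where p: "p \<in> x" "length p = len x" by blast
  then have "cox_eq \<Gamma> q p" using q by (simp add: cox_class_def)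
  then show thesis using that[of p] p cox_eq_lists cox_class_eq q by blast
qed

text \<open>Every relator has even length \<open>2 * n\<close>. This invariant is what excludes
  \<open>len (x \<cdot> s i) = len x\<close> in \<open>length_mult_s\<close>.\<close>

lemma parity_cong: "cox_eq \<Gamma> p q \<Longrightarrow> even (length p) = even (length q)"
proof (induction rule: cox_eq.induct)
  case (rel p q i j n)
  have "length (concat (replicate n [i, j])) = 2 * n" by (induction n) auto
  then show ?case by simp
qed auto

lemma parity_length:
  assumes "p \<in> lists S" shows "even (len (cox_class \<Gamma> p)) = even (length p)"
proof -
  obtain q where "q \<in> lists S" "cox_class \<Gamma> p = cox_class \<Gamma> q" "length q = len (cox_class \<Gamma> p)"
    using length_E[OF class_in_W[OF assms]] by metis
  moreover from this have "cox_eq \<Gamma> p q" using mem_class[of q] by (auto simp: cox_class_def)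
  ultimately show ?thesis using parity_cong by metis
qed

lemma length_mult_le: "x \<in> W \<Longrightarrow> y \<in> W \<Longrightarrow> len (x \<cdot> y) \<le> len x + len y"
proof -
  assume "x \<in> W" "y \<in> W"
  then obtain p q where "p \<in> lists S" "x = cox_class \<Gamma> p" "length p = len x"
    "q \<in> lists S" "y = cox_class \<Gamma> q" "length q = len y" by (metis length_E)
  then show ?thesis using length_le[of "p @ q"] by (simp add: class_append)
qed

lemma length_inv_le: "x \<in> W \<Longrightarrow> len (ginv x) \<le> len x"
proof -
  assume "x \<in> W"
  then obtain p where "p \<in> lists S" "x = cox_class \<Gamma> p" "length p = len x" by (rule length_E)
  then show ?thesis using length_le[of "rev p"] by (simp add: inv_class in_lists_conv_set)
qed

lemma length_inv: "x \<in> W \<Longrightarrow> len (ginv x) = len x"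
  using length_inv_le[of x] length_inv_le[of "ginv x"] by simp

lemma length_one [simp]: "len e1 = 0"
  using length_le[of "[]"] by (simp add: one_eq)

lemma length_0: "x \<in> W \<Longrightarrow> len x = 0 \<Longrightarrow> x = e1"
  by (auto simp: one_eq elim: length_E)

lemma length_s_le: "i \<in> S \<Longrightarrow> len (s i) \<le> 1"
  using length_le[of "[i]"] by (simp add: cox_gen_def)

lemma length_mult_s:
  assumes "x \<in> W" "i \<in> S"
  shows "len (x \<cdot> s i) = len x + 1 \<or> len x = len (x \<cdot> s i) + 1"
proof -
  have "len (x \<cdot> s i) \<le> len x + 1"
    using length_mult_le[of x "s i"] length_s_le[of i] assms by simp
  moreover have "len x \<le> len (x \<cdot> s i) + 1"
    using length_mult_le[of "x \<cdot> s i" "s i"] length_s_le[of i] assms by simp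
  moreover have "even (len (x \<cdot> s i)) \<noteq> even (len x)"
  proof -
    obtain p where p: "p \<in> lists S" "x = cox_class \<Gamma> p" using assms by (auto elim: W_E)
    then show ?thesis using parity_length[of p] parity_length[of "p @ [i]"] assms
      by (simp add: class_snoc)
  qed
  ultimately show ?thesis by presburger
qed

lemma descent_ex:
  assumes "x \<in> W" "x \<noteq> e1" obtains j where "j \<in> S" "len (x \<cdot> s j) < len x"
proof -
  obtain p where p: "p \<in> lists S" "x = cox_class \<Gamma> p" "length p = len x" using assms by (auto elim: length_E)
  then have "p \<noteq> []" using assms(2) one_eq by auto
  then obtain q j where q: "p = q @ [j]" using rev_exhaust by blast
  then have "q \<in> lists S" "j \<in> S" using p by auto
  moreover from this have "x \<cdot> s j = cox_class \<Gamma> q" using p q by (simp add: class_snoc class_in_W)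
  ultimately show thesis using that p q length_le[of q] by simp
qed


section \<open>The action\<close>

lemma act_one [simp]: "e1 \<bullet> v = v"
  using act_cox_class[OF diagram, of "[]"] by (simp add: one_eq word_act_def)

lemma act_mult: "x \<in> W \<Longrightarrow> y \<in> W \<Longrightarrow> (x \<cdot> y) \<bullet> v = x \<bullet> y \<bullet> v"
proof -
  assume "x \<in> W" "y \<in> W"
  then obtain p q where pq: "p \<in> lists S" "q \<in> lists S" "x = cox_class \<Gamma> p" "y = cox_class \<Gamma> q"
    by (metis W_E)
  then have "p @ q \<in> lists S" by simp
  with pq show ?thesis
    by (simp only: class_append[symmetric] act_cox_class[OF diagram] word_act_append)
qed

lemma act_inv [simp]: "x \<in> W \<Longrightarrow> ginv x \<bullet> x \<bullet> v = v" "x \<in> W \<Longrightarrow> x \<bullet> ginv x \<bullet> v = v"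
  by (simp_all add: act_mult[symmetric])

lemma act_s: "i \<in> S \<Longrightarrow> s i \<bullet> v = gen_act \<Gamma> i v"
  using act_cox_class[OF diagram, of "[i]" v] by (simp add: cox_gen_def word_act_def)

lemma gen_act_lin:
  "gen_act \<Gamma> i (\<lambda>k. a * u k + b * v k) = (\<lambda>k. a * gen_act \<Gamma> i u k + b * gen_act \<Gamma> i v k)"
  by (simp add: gen_act_def fun_eq_iff algebra_simps sum.distrib sum_distrib_left)

lemma act_lin: "x \<in> W \<Longrightarrow> x \<bullet> (\<lambda>k. a * u k + b * v k) = (\<lambda>k. a * (x \<bullet> u) k + b * (x \<bullet> v) k)"
proof (induction arbitrary: u v rule: W_induct)
  case one
  then show ?case by simp
next
  case (snoc x i)
  then show ?case by (simp add: act_mult act_s gen_act_lin)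
qed

lemma act_scale: "x \<in> W \<Longrightarrow> x \<bullet> (\<lambda>k. a * u k) = (\<lambda>k. a * (x \<bullet> u) k)"
  using act_lin[of x a u 0 u] by simp

lemma act_minus: "x \<in> W \<Longrightarrow> x \<bullet> (\<lambda>k. - u k) = (\<lambda>k. - (x \<bullet> u) k)"
  using act_scale[of x "-1" u] by simp

lemma act_zero: "x \<in> W \<Longrightarrow> x \<bullet> (\<lambda>k. 0) = (\<lambda>k. 0)"
  using act_scale[of x 0 "\<lambda>k. 0"] by simp

lemma act_sum:
  assumes "x \<in> W" "finite M"
  shows "x \<bullet> (\<lambda>k. \<Sum>m\<in>M. c m * f m k) = (\<lambda>k. \<Sum>m\<in>M. c m * (x \<bullet> f m) k)"
  using assms(2)
proof induction
  case empty
  then show ?case using act_zero[OF assms(1)] by simp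
next
  case (insert m M)
  then show ?case
    using act_lin[OF assms(1), of "c m" "f m" 1 "\<lambda>k. \<Sum>m\<in>M. c m * f m k"] by simp
qed

section \<open>Supports and coordinates\<close>

definition supp :: "'a set \<Rightarrow> ('a \<Rightarrow> real) \<Rightarrow> bool" where
  "supp M v \<longleftrightarrow> (\<forall>k. k \<notin> M \<longrightarrow> v k = 0)"

lemma supp_expand:
  assumes "finite M" "supp M v" shows "v = (\<lambda>k. \<Sum>m\<in>M. v m * \<alpha> m k)"
proof
  fix k
  have "(\<Sum>m\<in>M. v m * \<alpha> m k) = (\<Sum>m\<in>M. if k = m then v m else 0)"
    by (intro sum.cong) (auto simp: simple_root_def)
  also have "\<dots> = v k" using assms by (simp add: supp_def)
  finally show "v k = (\<Sum>m\<in>M. v m * \<alpha> m k)" by simp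
qed

lemma act_expand:
  assumes "x \<in> W" "finite M" "supp M v"
  shows "x \<bullet> v = (\<lambda>k. \<Sum>m\<in>M. v m * (x \<bullet> \<alpha> m) k)"
  using act_sum[OF assms(1,2), of v \<alpha>] supp_expand[OF assms(2,3)] by simp

lemma supp_simple [simp]: "supp M (\<alpha> i) \<longleftrightarrow> i \<in> M"
  by (auto simp: supp_def simple_root_def)

lemma supp_mono: "supp M v \<Longrightarrow> M \<subseteq> N \<Longrightarrow> supp N v"
  by (auto simp: supp_def)

text \<open>The reflection \<open>s i\<close> changes a vector only by a multiple of
  \<open>\<alpha> i\<close>, that is, only in the coordinate \<open>i\<close>.\<close>

lemma act_outside:
  assumes "M \<subseteq> S" "x \<in> parabolic \<Gamma> M" "k \<notin> M" shows "(x \<bullet> v) k = v k"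
  using assms(1,2)
proof (induction arbitrary: v rule: parabolic_induct)
  case one
  then show ?case by simp
next
  case (snoc x i)
  then have "x \<in> W" "i \<in> S" "k \<noteq> i" using assms parabolic_in_W by auto
  then show ?case using snoc by (simp add: act_mult act_s gen_act_def simple_root_def)
qed

lemma supp_act: "M \<subseteq> S \<Longrightarrow> x \<in> parabolic \<Gamma> M \<Longrightarrow> supp M v \<Longrightarrow> supp M (x \<bullet> v)"
  by (simp add: supp_def act_outside)

lemma simple_inj: "\<alpha> i = \<alpha> j \<longleftrightarrow> i = j"
  by (auto simp: simple_root_def fun_eq_iff split: if_splits)

lemma act_inj: "x \<in> W \<Longrightarrow> x \<bullet> u = x \<bullet> v \<longleftrightarrow> u = v"
  by (metis act_inv(1))

lemma s_simple: "i \<in> S \<Longrightarrow> j \<in> S \<Longrightarrow> s i \<bullet> \<alpha> j = (\<lambda>k. \<alpha> j k - 2 * cox_form \<Gamma> i j * \<alpha> i k)"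
  using form_simple_root[OF diagram, of j i "\<lambda>k. 0" 1] by (simp add: act_s gen_act_def)

lemma form_diag: "i \<in> S \<Longrightarrow> cox_form \<Gamma> i i = 1"
  using diagram by (auto simp: cox_form_def is_coxeter_diagram_def one_enat_def)

lemma form_sym: "i \<in> S \<Longrightarrow> j \<in> S \<Longrightarrow> cox_form \<Gamma> i j = cox_form \<Gamma> j i"
  using diagram by (auto simp: cox_form_def is_coxeter_diagram_def)

lemma s_self: "i \<in> S \<Longrightarrow> s i \<bullet> \<alpha> i = (\<lambda>k. - \<alpha> i k)"
  by (simp add: s_simple form_diag)


section \<open>Positive and negative roots\<close>

lemma alt_class_Suc:
  "i \<in> S \<Longrightarrow> j \<in> S \<Longrightarrow> cox_class \<Gamma> (alt i j (Suc k)) = s (if even k then j else i) \<cdot> cox_class \<Gamma> (alt i j k)"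
  by (simp add: class_Cons alt_lists)

text \<open>In the plane of \<open>\<alpha> i\<close> and \<open>\<alpha> j\<close> each reflection
  replaces one coordinate \<open>p\<close> by \<open>2 * c * q - p\<close>, where \<open>q\<close>
  is the other one. This is the recurrence of \<open>cheb\<close>.\<close>

lemma act_alt:
  assumes "i \<in> S" "j \<in> S"
  defines "c \<equiv> - cox_form \<Gamma> i j"
  shows "cox_class \<Gamma> (alt i j k) \<bullet> \<alpha> i =
    (if even k then (\<lambda>l. cheb c (Suc k) * \<alpha> i l + cheb c k * \<alpha> j l)
     else (\<lambda>l. cheb c k * \<alpha> i l + cheb c (Suc k) * \<alpha> j l))"
proof (induction k)
  case 0
  then show ?case using act_one by (simp add: one_eq)
next
  case (Suc k)
  have i: "s i \<bullet> \<alpha> j = (\<lambda>l. \<alpha> j l + 2 * c * \<alpha> i l)" and j: "s j \<bullet> \<alpha> i = (\<lambda>l. \<alpha> i l + 2 * c * \<alpha> j l)"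
    using assms form_sym[of i j] by (auto simp: s_simple)
  have *: "cox_class \<Gamma> (alt i j (Suc k)) \<bullet> \<alpha> i =
      s (if even k then j else i) \<bullet> cox_class \<Gamma> (alt i j k) \<bullet> \<alpha> i"
    unfolding alt_class_Suc[OF assms(1,2)] using assms(1,2)
    by (intro act_mult class_in_W alt_lists) auto
  have "s i \<bullet> (\<lambda>l. p * \<alpha> i l + q * \<alpha> j l) = (\<lambda>l. (2 * c * q - p) * \<alpha> i l + q * \<alpha> j l)"
    "s j \<bullet> (\<lambda>l. p * \<alpha> i l + q * \<alpha> j l) = (\<lambda>l. p * \<alpha> i l + (2 * c * p - q) * \<alpha> j l)" for p q
    using assms(1,2) by (simp_all add: act_lin s_self i j fun_eq_iff algebra_simps)
  then show ?case unfolding * Suc by simp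
qed

text \<open>For a finite label \<open>m\<close> the value is
  \<open>sin (k * pi / m) / sin (pi / m)\<close>, and \<open>k \<le> m\<close> keeps the angle in
  the interval from \<open>0\<close> to \<open>pi\<close>.\<close>

lemma cheb_nonneg:
  assumes "i \<in> S" "j \<in> S" "i \<noteq> j" and k: "\<And>m. cox_m \<Gamma> i j = enat m \<Longrightarrow> k \<le> m"
  shows "0 \<le> cheb (- cox_form \<Gamma> i j) k"
proof (cases "cox_m \<Gamma> i j")
  case (enat m)
  have "(2 :: enat) \<le> enat m"
    using assms enat diagram unfolding is_coxeter_diagram_def by metis
  then have m: "2 \<le> m" by (simp add: numeral_eq_enat)
  then have "0 < sin (pi / real m)" by (intro sin_gt_zero) (auto simp: field_simps)
  moreover have "0 \<le> sin (real k * (pi / real m))"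
    using m k[OF enat] by (intro sin_ge_zero) (auto simp: field_simps)
  ultimately have "0 \<le> cheb (cos (pi / real m)) k"
    using cheb_cos[of "pi / real m" k] by (metis mult_less_0_iff not_le)
  then show ?thesis using enat by (simp add: cox_form_def)
next
  case infinity
  then show ?thesis by (simp add: cox_form_def cheb_1)
qed

text \<open>If \<open>m \<le> k\<close>, then \<open>w \<cdot> s i\<close> is \<open>v\<close> times
  an alternating word of length \<open>k + 1\<close>, whose last \<open>m + 1\<close> letters can be
  replaced by \<open>m - 1\<close> letters. So \<open>w \<cdot> s i\<close> would be shorter than
  \<open>w\<close>.\<close>

lemma dihedral_bound:
  assumes "i \<in> S" "j \<in> S" "v \<in> W" "w = v \<cdot> cox_class \<Gamma> (alt i j k)" "len v + k = len w"
    "len w < len (w \<cdot> s i)" "cox_m \<Gamma> i j = enat m"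
  shows "k < m"
proof (rule ccontr)
  assume "\<not> k < m"
  then have k: "m \<le> k" by simp
  have "cox_m \<Gamma> i j \<noteq> 0"
  proof (cases "i = j")
    case True
    then show ?thesis using assms diagram by (auto simp: is_coxeter_diagram_def)
  next
    case False
    then have "2 \<le> cox_m \<Gamma> i j" using assms(1,2) diagram by (simp add: is_coxeter_diagram_def)
    then show ?thesis by auto
  qed
  then have m: "0 < m" using assms(7) by (simp add: zero_enat_def)
  have m': "cox_m \<Gamma> j i = enat m"
    using assms diagram by (metis is_coxeter_diagram_def)
  have L: "alt j i n \<in> lists S" "alt i j n \<in> lists S" for n using assms alt_lists by metis+
  \<comment> \<open>The relator of length \<open>2 * m\<close> is cut into \<open>m - 1\<close> and
    \<open>m + 1\<close> letters, so the second piece is the inverse of the first. Positivity of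
    \<open>m\<close> makes the subtraction exact.\<close>
  have short: "len (cox_class \<Gamma> (alt j i (Suc m))) \<le> m - 1"
  proof -
    obtain q where q: "q \<in> lists S" "length q = m - 1" "alt j i (2 * m) = q @ alt j i (Suc m)"
      using alt_split[of j S i "m - 1" "Suc m"] assms(1,2) m by (auto simp: mult_2)
    have "cox_eq \<Gamma> ([] @ concat (replicate m [j, i]) @ []) ([] @ [])"
      using assms m' by (intro cox_eq.rel) auto
    then have "cox_class \<Gamma> (q @ alt j i (Suc m)) = e1"
      using q(3) cox_class_eq[of \<Gamma> "q @ alt j i (Suc m)" "[]"]
      by (simp only: alt_double one_eq append_Nil append_Nil2)
    then have "cox_class \<Gamma> q \<cdot> cox_class \<Gamma> (alt j i (Suc m)) = e1"
      using class_append[OF q(1) L(1)[of "Suc m"]] by metis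
    then have "cox_class \<Gamma> q = ginv (cox_class \<Gamma> (alt j i (Suc m)))"
      using inv_equality[OF _ class_in_W[OF L(1)[of "Suc m"]] class_in_W[OF q(1)]] by simp
    then have "len (cox_class \<Gamma> (alt j i (Suc m))) = len (cox_class \<Gamma> q)"
      using length_inv[OF class_in_W[OF L(1)[of "Suc m"]]] by metis
    then show ?thesis using length_le[OF q(1)] q(2) by simp
  qed
  obtain q where q: "q \<in> lists S" "length q = k - m" "alt j i (Suc k) = q @ alt j i (Suc m)"
    using alt_split[of j S i "k - m" "Suc m"] assms(1,2) k by auto
  have "w \<cdot> s i = v \<cdot> cox_class \<Gamma> (alt j i (Suc k))"
    using assms L(2)[of k] class_snoc[of i "alt i j k"] by (simp add: m_assoc class_in_W alt_snoc)
  also have "\<dots> = v \<cdot> (cox_class \<Gamma> q \<cdot> cox_class \<Gamma> (alt j i (Suc m)))"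
    using class_append[OF q(1) L(1)[of "Suc m"]] unfolding q(3) by simp
  finally have "len (w \<cdot> s i) \<le> len v + (len (cox_class \<Gamma> q) + len (cox_class \<Gamma> (alt j i (Suc m))))"
    using length_mult_le[OF class_in_W[OF q(1)] class_in_W[OF L(1)[of "Suc m"]]]
      length_mult_le[OF assms(3), of "cox_class \<Gamma> q \<cdot> cox_class \<Gamma> (alt j i (Suc m))"]
      class_in_W[OF q(1)] class_in_W[OF L(1)[of "Suc m"]] by simp
  then have "len (w \<cdot> s i) \<le> len v + (k - m + (m - 1))"
    using short length_le[OF q(1)] q(2) by linarith
  then show False using assms(5,6) m k by linarith
qed

text \<open>Split off from \<open>w\<close> a longest alternating right factor in \<open>i\<close> and a right descent \<open>j\<close>;
  the remaining factor has neither \<open>i\<close> nor \<open>j\<close> as a descent.\<close>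

lemma ascent_nonneg: "w \<in> W \<Longrightarrow> i \<in> S \<Longrightarrow> len w < len (w \<cdot> s i) \<Longrightarrow> nonneg (w \<bullet> \<alpha> i)"
proof (induction "len w" arbitrary: w i rule: less_induct)
  case less
  show ?case
  proof (cases "w = e1")
    case True
    then show ?thesis by simp
  next
    case False
    obtain j where j: "j \<in> S" "len (w \<cdot> s j) < len w" using descent_ex[OF less(2) False] .
    then have ij: "i \<noteq> j" using less(4) by auto
    define d where "d k = cox_class \<Gamma> (alt i j k)" for k
    have dW [simp]: "d k \<in> W" for k using j less(3) by (simp add: d_def class_in_W alt_lists)
    have dS: "d (Suc k) = s (if even k then j else i) \<cdot> d k" for k
      unfolding d_def using less(3) j(1) by (rule alt_class_Suc)
    have d0: "d 0 = e1" by (simp add: d_def one_eq)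
    have dl: "len (d k) \<le> k" for k
      using length_le[OF alt_lists[OF less(3) j(1)], of k] by (simp add: d_def)
    define Q where "Q k \<longleftrightarrow> (\<exists>v\<in>W. w = v \<cdot> d k \<and> len v + k = len w)" for k
    have "Q 1"
    proof -
      have "d 1 = s j" using dS[of 0] d0 j(1) by simp
      then have "w = (w \<cdot> s j) \<cdot> d 1" using less(2) j(1) by simp
      moreover have "len (w \<cdot> s j) + 1 = len w" using length_mult_s[OF less(2) j(1)] j(2) by auto
      ultimately show ?thesis unfolding Q_def using m_closed[OF less(2) s_in_W[OF j(1)]] by blast
    qed
    moreover have bd: "k \<le> len w" if "Q k" for k using that by (auto simp: Q_def)
    ultimately obtain k where k: "Q k" "\<And>k'. Q k' \<Longrightarrow> k' \<le> k"
      using Greatest_le_nat[of Q _ "len w"] GreatestI_nat[of Q 1 "len w"] by blast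
    then have k1: "1 \<le> k" using \<open>Q 1\<close> by blast
    obtain v where v: "v \<in> W" "w = v \<cdot> d k" "len v + k = len w" using k(1) by (auto simp: Q_def)
    \<comment> \<open>\<open>c'\<close> is the letter that would extend the alternating factor to
      the left; it is no descent of \<open>v\<close> because \<open>k\<close> is maximal.
      \<open>c\<close> is the first letter of \<open>d k\<close>; it is no descent of
      \<open>v\<close> because \<open>v \<cdot> s c\<close> times the other \<open>k - 1\<close>
      letters is still \<open>w\<close>.\<close>
    define c' where "c' = (if even k then j else i)"
    define c where "c = (if even k then i else j)"
    have cS: "c \<in> S" "c' \<in> S" using less(3) j by (auto simp: c_def c'_def)
    have c': "len v < len (v \<cdot> s c')"
    proof (rule ccontr)
      assume "\<not> ?thesis"
      then have "len (v \<cdot> s c') + 1 = len v" using length_mult_s[OF v(1) cS(2)] by auto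
      moreover have "w = (v \<cdot> s c') \<cdot> d (Suc k)"
        using v cS dS[of k] by (simp add: c'_def[symmetric] m_assoc[symmetric])
      ultimately have "Q (Suc k)" unfolding Q_def using v cS by (intro bexI[of _ "v \<cdot> s c'"]) auto
      then show False using k(2) by fastforce
    qed
    have c: "len v < len (v \<cdot> s c)"
    proof -
      obtain k' where k': "k = Suc k'" using k1 by (cases k) auto
      then have "d k = s c \<cdot> d k'" using dS[of k'] by (auto simp: c_def)
      then have "w = (v \<cdot> s c) \<cdot> d k'" using v cS by (simp add: m_assoc)
      then have "len w \<le> len (v \<cdot> s c) + k'"
        using length_mult_le[of "v \<cdot> s c" "d k'"] dl[of k'] v cS by simp
      then show ?thesis using v(3) k' by simp
    qed
    have "len v < len w" using v(3) k1 by simp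
    then have "nonneg (v \<bullet> \<alpha> c)" "nonneg (v \<bullet> \<alpha> c')"
      using less(1)[of v] v cS c c' by auto
    then have n: "nonneg (v \<bullet> \<alpha> i)" "nonneg (v \<bullet> \<alpha> j)"
      by (auto simp: c_def c'_def split: if_splits)
    have km: "k < m" if "cox_m \<Gamma> i j = enat m" for m
      using dihedral_bound[OF less(3) j(1) v(1) v(2)[unfolded d_def] v(3) less(4) that] .
    \<comment> \<open>By \<open>act_alt\<close> the coefficients of
      \<open>d k \<bullet> \<alpha> i\<close> have indices \<open>k\<close> and
      \<open>Suc k\<close>; the strict bound \<open>k < m\<close> admits both.\<close>
    have "0 \<le> cheb (- cox_form \<Gamma> i j) k" "0 \<le> cheb (- cox_form \<Gamma> i j) (Suc k)"
      using km by (auto intro!: cheb_nonneg less j ij simp: Suc_le_eq less_imp_le)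
    moreover have "w \<bullet> \<alpha> i = v \<bullet> d k \<bullet> \<alpha> i" using v by (simp add: act_mult)
    ultimately show ?thesis
      unfolding d_def act_alt[OF less(3) j(1)] using v n by (simp add: act_lin nonneg_add)
  qed
qed

definition is_root :: "('a \<Rightarrow> real) \<Rightarrow> bool" where
  "is_root \<beta> \<longleftrightarrow> (\<exists>x\<in>W. \<exists>i\<in>S. \<beta> = x \<bullet> \<alpha> i)"

lemma descent_nonpos:
  assumes "w \<in> W" "i \<in> S" "len (w \<cdot> s i) < len w" shows "nonpos (w \<bullet> \<alpha> i)"
proof -
  have "nonneg ((w \<cdot> s i) \<bullet> \<alpha> i)" using assms by (intro ascent_nonneg) auto
  then show ?thesis using assms by (simp add: act_mult s_self act_minus)
qed

lemma root_cases: "is_root \<beta> \<Longrightarrow> nonneg \<beta> \<or> nonpos \<beta>"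
  unfolding is_root_def using ascent_nonneg descent_nonpos length_mult_s by (metis less_add_one)

lemma root_nonzero: "is_root \<beta> \<Longrightarrow> \<beta> \<noteq> (\<lambda>k. 0)"
proof
  assume "is_root \<beta>" "\<beta> = (\<lambda>k. 0)"
  then obtain x i where x: "x \<in> W" "i \<in> S" "x \<bullet> \<alpha> i = (\<lambda>k. 0)" unfolding is_root_def by metis
  have "\<alpha> i = ginv x \<bullet> x \<bullet> \<alpha> i" using x(1) by simp
  then have "\<alpha> i = (\<lambda>k. 0)" unfolding x(3) using act_zero[of "ginv x"] x(1) by simp
  then have "\<alpha> i i = 0" by (simp only:)
  then show False by (simp add: simple_root_def)
qed

lemma root_not_both: "is_root \<beta> \<Longrightarrow> nonneg \<beta> \<Longrightarrow> nonpos \<beta> \<Longrightarrow> False"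
  using root_nonzero[of \<beta>] by (auto simp: nonneg_def nonpos_def fun_eq_iff order.antisym)

lemma is_root_act: "is_root \<beta> \<Longrightarrow> x \<in> W \<Longrightarrow> is_root (x \<bullet> \<beta>)"
  unfolding is_root_def by (metis act_mult m_closed)

lemma is_root_simple: "i \<in> S \<Longrightarrow> is_root (\<alpha> i)"
  unfolding is_root_def by (rule bexI[of _ e1]) auto

lemma is_root_minus: "is_root \<beta> \<Longrightarrow> is_root (\<lambda>k. - \<beta> k)"
proof -
  assume "is_root \<beta>"
  then obtain x i where x: "x \<in> W" "i \<in> S" "\<beta> = x \<bullet> \<alpha> i" unfolding is_root_def by metis
  then have "(\<lambda>k. - \<beta> k) = (x \<cdot> s i) \<bullet> \<alpha> i" by (simp add: act_mult s_self act_minus)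
  then show ?thesis unfolding is_root_def using x by (metis m_closed s_in_W)
qed

lemma ascent_iff:
  assumes "w \<in> W" "i \<in> S" shows "len (w \<cdot> s i) = len w + 1 \<longleftrightarrow> nonneg (w \<bullet> \<alpha> i)"
  using assms length_mult_s[OF assms] ascent_nonneg[OF assms] descent_nonpos[OF assms]
    root_not_both[OF is_root_act[OF is_root_simple[OF assms(2)] assms(1)]]
  by (metis less_add_one)

lemma descent_iff:
  assumes "w \<in> W" "i \<in> S" shows "len w = len (w \<cdot> s i) + 1 \<longleftrightarrow> nonpos (w \<bullet> \<alpha> i)"
  using assms length_mult_s[OF assms] ascent_nonneg[OF assms] descent_nonpos[OF assms]
    root_not_both[OF is_root_act[OF is_root_simple[OF assms(2)] assms(1)]]
  by (metis less_add_one)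

lemma is_root_parabolic:
  "M \<subseteq> S \<Longrightarrow> \<beta> \<in> roots \<Gamma> M \<Longrightarrow> is_root \<beta> \<and> supp M \<beta>"
  unfolding roots_def is_root_def using parabolic_in_W supp_act supp_simple by blast

section \<open>Minimal coset representatives of parabolic subgroups\<close>

lemma nonneg_act:
  assumes "M \<subseteq> S" "y \<in> W" "\<And>m. m \<in> M \<Longrightarrow> nonneg (y \<bullet> \<alpha> m)" "supp M \<beta>" "nonneg \<beta>"
  shows "nonneg (y \<bullet> \<beta>)"
  unfolding act_expand[OF assms(2) finite_sub[OF assms(1)] assms(4)]
  using assms by (intro nonneg_sum) (auto simp: nonneg_def)

lemma nonpos_act:
  assumes "M \<subseteq> S" "y \<in> W" "\<And>m. m \<in> M \<Longrightarrow> nonneg (y \<bullet> \<alpha> m)" "supp M \<beta>" "nonpos \<beta>"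
  shows "nonpos (y \<bullet> \<beta>)"
  using nonneg_act[OF assms(1-3), of "\<lambda>k. - \<beta> k"] assms by (simp add: act_minus supp_def)

lemma nonneg_act_iff:
  assumes "M \<subseteq> S" "y \<in> W" "\<And>m. m \<in> M \<Longrightarrow> nonneg (y \<bullet> \<alpha> m)" "supp M \<beta>" "is_root \<beta>"
  shows "nonneg (y \<bullet> \<beta>) \<longleftrightarrow> nonneg \<beta>" "nonpos (y \<bullet> \<beta>) \<longleftrightarrow> nonpos \<beta>"
  using nonneg_act[OF assms(1-4)] nonpos_act[OF assms(1-4)] root_cases[OF assms(5)]
    root_not_both[OF is_root_act[OF assms(5,2)]] root_not_both[OF assms(5)] by blast+

text \<open>Since \<open>y\<close> preserves signs of roots supported on \<open>M\<close>, the roots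
  \<open>u \<bullet> \<alpha> i\<close> and \<open>y \<bullet> u \<bullet> \<alpha> i\<close> have
  the same sign. So appending a letter of \<open>M\<close> changes the lengths of \<open>u\<close>
  and of \<open>y \<cdot> u\<close> in the same way.\<close>

lemma length_add:
  assumes M: "M \<subseteq> S" and y: "y \<in> W" "\<And>m. m \<in> M \<Longrightarrow> nonneg (y \<bullet> \<alpha> m)" and u: "u \<in> parabolic \<Gamma> M"
  shows "len (y \<cdot> u) = len y + len u"
  using M u
proof (induction rule: parabolic_induct)
  case one
  then show ?case using y by simp
next
  case (snoc u i)
  have u: "u \<in> W" "i \<in> S" using snoc M parabolic_in_W by auto
  have "supp M (u \<bullet> \<alpha> i)" "is_root (u \<bullet> \<alpha> i)"
    using supp_act[OF M snoc(1)] snoc u is_root_act is_root_simple by auto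
  then have "nonneg (y \<bullet> u \<bullet> \<alpha> i) \<longleftrightarrow> nonneg (u \<bullet> \<alpha> i)"
    using nonneg_act_iff[OF M y] by blast
  then have "len (y \<cdot> u \<cdot> s i) = len (y \<cdot> u) + 1 \<longleftrightarrow> len (u \<cdot> s i) = len u + 1"
    using ascent_iff[of "y \<cdot> u" i] ascent_iff[of u i] u y by (simp add: act_mult)
  then have "len (y \<cdot> u \<cdot> s i) = len y + len (u \<cdot> s i)"
    using length_mult_s[OF m_closed[OF y(1) u(1)] u(2)] length_mult_s[OF u] snoc(3) by linarith
  then show ?case using u y by (simp add: m_assoc)
qed

text \<open>Here \<open>z\<close> is itself a minimal representative of its coset, and
  \<open>length_add\<close> applied to \<open>z \<cdot> ginv z\<close> gives
  \<open>0 = len z + len (ginv z)\<close>. All later uniqueness arguments end with this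
  lemma.\<close>

lemma parabolic_eq_one:
  assumes "M \<subseteq> S" "z \<in> parabolic \<Gamma> M" "\<And>m. m \<in> M \<Longrightarrow> nonneg (z \<bullet> \<alpha> m)"
  shows "z = e1"
proof -
  have z: "z \<in> W" using assms parabolic_in_W by blast
  have "len (z \<cdot> ginv z) = len z + len (ginv z)"
    using length_add[OF assms(1) z assms(3) parabolic_inv[OF assms(1,2)]] .
  then show ?thesis using z length_0 by simp
qed

text \<open>A shortest element of the coset of \<open>x\<close> serves as \<open>y\<close>: right
  multiplication by \<open>s m\<close> stays in the coset and cannot shorten
  \<open>y\<close>.\<close>

lemma coset_decomposition:
  assumes "M \<subseteq> S" "x \<in> W"
  obtains y u where "y \<in> W" "u \<in> parabolic \<Gamma> M" "x = y \<cdot> u" "\<And>m. m \<in> M \<Longrightarrow> nonneg (y \<bullet> \<alpha> m)"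
proof -
  define Q where "Q y \<longleftrightarrow> y \<in> W \<and> (\<exists>u\<in>parabolic \<Gamma> M. x = y \<cdot> u)" for y
  have "Q x" unfolding Q_def using assms parabolic_one by (auto intro!: bexI[of _ e1])
  then obtain y where y: "Q y" "\<And>z. Q z \<Longrightarrow> len y \<le> len z"
    using ex_has_least_nat[of Q x len] by blast
  then obtain u where u: "y \<in> W" "u \<in> parabolic \<Gamma> M" "x = y \<cdot> u" by (auto simp: Q_def)
  have "nonneg (y \<bullet> \<alpha> m)" if "m \<in> M" for m
  proof -
    have m: "m \<in> S" "s m \<in> parabolic \<Gamma> M" using that assms parabolic_gen by auto
    have "Q (y \<cdot> s m)" unfolding Q_def
      using u m assms parabolic_mult[OF assms(1) m(2) u(2)] parabolic_in_W[OF assms(1) u(2)]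
      by (intro conjI bexI[of _ "s m \<cdot> u"]) (simp_all add: m_assoc[symmetric])
    then have "len y \<le> len (y \<cdot> s m)" using y(2) by blast
    then show ?thesis using length_mult_s[OF u(1) m(1)] ascent_iff[OF u(1) m(1)] by auto
  qed
  then show thesis using that u by blast
qed

lemma faithful:
  assumes "x \<in> W" "y \<in> W" "\<And>i. i \<in> S \<Longrightarrow> x \<bullet> \<alpha> i = y \<bullet> \<alpha> i" shows "x = y"
proof -
  have "parabolic \<Gamma> S = W"
    using parabolic_in_W[OF subset_refl] parabolic_class[OF subset_refl] W_E by (metis subsetI subset_antisym)
  then have "ginv y \<cdot> x = e1"
    using assms by (intro parabolic_eq_one[of S]) (auto simp: act_mult)
  then have "y \<cdot> (ginv y \<cdot> x) = y" using assms by simp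
  then show ?thesis using assms by simp
qed


section \<open>The invariant form\<close>

definition bform :: "('a \<Rightarrow> real) \<Rightarrow> ('a \<Rightarrow> real) \<Rightarrow> real" where
  "bform u v = (\<Sum>i\<in>S. u i * (\<Sum>j\<in>S. cox_form \<Gamma> i j * v j))"

lemma bform_sym: "bform u v = bform v u"
proof -
  have "bform u v = (\<Sum>i\<in>S. \<Sum>j\<in>S. u i * (cox_form \<Gamma> i j * v j))"
    by (simp add: bform_def sum_distrib_left)
  also have "\<dots> = (\<Sum>j\<in>S. \<Sum>i\<in>S. u i * (cox_form \<Gamma> i j * v j))" by (rule sum.swap)
  also have "\<dots> = (\<Sum>j\<in>S. \<Sum>i\<in>S. v j * (cox_form \<Gamma> j i * u i))"
    by (intro sum.cong) (auto simp: form_sym)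
  also have "\<dots> = bform v u" by (simp add: bform_def sum_distrib_left)
  finally show ?thesis .
qed

lemma bform_lin: "bform (\<lambda>k. a * u k + b * v k) z = a * bform u z + b * bform v z"
  by (simp add: bform_def algebra_simps sum.distrib sum_distrib_left)

lemma bform_lin2: "bform z (\<lambda>k. a * u k + b * v k) = a * bform z u + b * bform z v"
  using bform_lin[of a u b v z] by (simp add: bform_sym)

lemma bform_simple: "i \<in> S \<Longrightarrow> bform (\<alpha> i) v = (\<Sum>j\<in>S. cox_form \<Gamma> i j * v j)"
proof -
  assume i: "i \<in> S"
  have "bform (\<alpha> i) v = (\<Sum>k\<in>S. if k = i then (\<Sum>j\<in>S. cox_form \<Gamma> k j * v j) else 0)"
    unfolding bform_def by (intro sum.cong) (auto simp: simple_root_def)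
  then show ?thesis using i finite_S by simp
qed

lemma s_act: "i \<in> S \<Longrightarrow> s i \<bullet> v = (\<lambda>k. 1 * v k + (- 2 * bform (\<alpha> i) v) * \<alpha> i k)"
  by (simp add: act_s gen_act_def bform_simple)

lemma bform_simple_simple: "i \<in> S \<Longrightarrow> j \<in> S \<Longrightarrow> bform (\<alpha> i) (\<alpha> j) = cox_form \<Gamma> i j"
  using form_simple_root[OF diagram, of j i "\<lambda>k. 0" 1] by (simp add: bform_simple)

lemma bform_s: "i \<in> S \<Longrightarrow> bform (s i \<bullet> u) (s i \<bullet> v) = bform u v"
  unfolding s_act bform_lin bform_lin2
  by (simp add: bform_simple_simple form_diag bform_sym[of u "\<alpha> i"] algebra_simps)

lemma bform_act: "x \<in> W \<Longrightarrow> bform (x \<bullet> u) (x \<bullet> v) = bform u v"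
proof (induction arbitrary: u v rule: W_induct)
  case one
  then show ?case by simp
next
  case (snoc x i)
  then show ?case by (simp add: act_mult bform_s)
qed

lemma bform_root: "is_root \<beta> \<Longrightarrow> bform \<beta> \<beta> = 1"
  unfolding is_root_def by (auto simp: bform_act bform_simple_simple form_diag)

text \<open>Because \<open>y\<close> preserves \<open>bform\<close>, it carries the reflection in
  \<open>\<alpha> i\<close> to the reflection in \<open>\<alpha> j\<close>; faithfulness turns this
  equality of actions into one in the group.\<close>

lemma conj_gen:
  assumes "y \<in> W" "i \<in> S" "j \<in> S" "y \<bullet> \<alpha> i = \<alpha> j"
  shows "y \<cdot> s i \<cdot> ginv y = s j"
proof (rule faithful)
  fix k assume "k \<in> S"
  have "y \<bullet> s i \<bullet> ginv y \<bullet> v = s j \<bullet> v" for v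
  proof -
    have "bform (\<alpha> i) (ginv y \<bullet> v) = bform (\<alpha> j) v"
      using bform_act[OF assms(1), of "\<alpha> i" "ginv y \<bullet> v"] assms by simp
    then show ?thesis using assms unfolding s_act[OF assms(2)] s_act[OF assms(3)] act_lin[OF assms(1)] by simp
  qed
  then show "(y \<cdot> s i \<cdot> ginv y) \<bullet> \<alpha> k = s j \<bullet> \<alpha> k" using assms by (simp add: act_mult)
qed (use assms in auto)

text \<open>All roots have norm \<open>1\<close> for \<open>bform\<close>, so
  \<open>c * c = 1\<close>.\<close>

lemma root_multiple:
  assumes "is_root \<beta>" "is_root \<gamma>" "\<beta> = (\<lambda>k. c * \<gamma> k)" shows "c = 1 \<or> c = -1"
proof -
  have "bform \<beta> \<beta> = c * (c * bform \<gamma> \<gamma>)"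
    unfolding assms(3) using bform_lin[of c \<gamma> 0 \<gamma>] bform_lin2[of _ c \<gamma> 0 \<gamma>] by simp
  then have "c * c = 1" using bform_root assms(1,2) by simp
  then show ?thesis by algebra
qed

text \<open>A simple root is extremal in the cone of nonnegative combinations of positive roots.\<close>

lemma simple_of_image:
  assumes M: "M \<subseteq> S" and y: "y \<in> W" and \<epsilon>: "\<epsilon> = 1 \<or> \<epsilon> = (-1::real)"
    and pos: "\<And>m. m \<in> M \<Longrightarrow> nonneg (\<lambda>l. \<epsilon> * (y \<bullet> \<alpha> m) l)"
    and \<beta>: "is_root \<beta>" "supp M \<beta>" "nonneg \<beta>" and eq: "\<And>l. \<epsilon> * (y \<bullet> \<beta>) l = \<alpha> k l"
  obtains m where "m \<in> M" "\<beta> = \<alpha> m"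
proof -
  \<comment> \<open>The sign \<open>\<epsilon>\<close> lets one argument serve coset representatives
    (\<open>1\<close>, in \<open>simple_preimage\<close>) and longest elements (\<open>-1\<close>,
    in \<open>opposition\<close>).\<close>
  have "\<exists>m\<in>M. \<beta> m \<noteq> 0" using root_nonzero[OF \<beta>(1)] \<beta>(2) by (auto simp: supp_def fun_eq_iff)
  then obtain m where m: "m \<in> M" "\<beta> m > 0" using \<beta>(3) by (force simp: nonneg_def order.order_iff_strict)
  have mS: "m \<in> S" using m M by blast
  \<comment> \<open>The coordinate \<open>l\<close> of the image is \<open>0\<close> and is a sum of
    nonnegative terms, so each term vanishes. As \<open>\<beta> m > 0\<close>, this makes
    \<open>y \<bullet> \<alpha> m\<close> a multiple of \<open>\<alpha> k\<close>.\<close>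
  have van: "(y \<bullet> \<alpha> m) l = 0" if l: "l \<noteq> k" for l
  proof -
    have "\<epsilon> * (y \<bullet> \<beta>) l = (\<Sum>m\<in>M. \<beta> m * (\<epsilon> * (y \<bullet> \<alpha> m) l))"
      unfolding act_expand[OF y finite_sub[OF M] \<beta>(2)] by (simp add: sum_distrib_left mult.left_commute)
    then have "(\<Sum>m\<in>M. \<beta> m * (\<epsilon> * (y \<bullet> \<alpha> m) l)) = 0" using eq[of l] l by (simp add: simple_root_def)
    moreover have "0 \<le> \<beta> n * (\<epsilon> * (y \<bullet> \<alpha> n) l)" if "n \<in> M" for n
      using pos[OF that] \<beta>(3) by (simp add: nonneg_def)
    ultimately have "\<beta> m * (\<epsilon> * (y \<bullet> \<alpha> m) l) = 0"
      using sum_nonneg_eq_0_iff[OF finite_sub[OF M], of "\<lambda>n. \<beta> n * (\<epsilon> * (y \<bullet> \<alpha> n) l)"] m(1) by simp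
    then show ?thesis using m \<epsilon> by auto
  qed
  define t where "t = (y \<bullet> \<alpha> m) k"
  have t: "y \<bullet> \<alpha> m = (\<lambda>l. t * \<alpha> k l)"
    using van by (auto simp: t_def simple_root_def)
  have t0: "t \<noteq> 0"
  proof
    assume "t = 0"
    then have "y \<bullet> \<alpha> m = (\<lambda>l. 0)" unfolding t by simp
    then show False using root_nonzero[OF is_root_act[OF is_root_simple[OF mS] y]] by blast
  qed
  have \<epsilon>2: "\<epsilon> * \<epsilon> = 1" using \<epsilon> by auto
  have yb: "y \<bullet> \<beta> = (\<lambda>l. \<epsilon> * \<alpha> k l)"
  proof
    fix l
    have "\<epsilon> * (\<epsilon> * (y \<bullet> \<beta>) l) = \<epsilon> * \<alpha> k l" using eq[of l] by simp
    then show "(y \<bullet> \<beta>) l = \<epsilon> * \<alpha> k l" using \<epsilon>2 by (simp add: mult.assoc[symmetric])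
  qed
  have "y \<bullet> (\<lambda>l. (\<epsilon> / t) * \<alpha> m l) = y \<bullet> \<beta>"
    unfolding act_scale[OF y] t yb using t0 by simp
  then have b: "\<beta> = (\<lambda>l. (\<epsilon> / t) * \<alpha> m l)" unfolding act_inj[OF y] by (rule HOL.sym)
  then have "\<epsilon> / t = 1 \<or> \<epsilon> / t = -1" using root_multiple[OF \<beta>(1) is_root_simple[OF mS]] by blast
  moreover have "\<beta> m = \<epsilon> / t" using fun_cong[OF b, of m] by (simp add: simple_root_def)
  ultimately have "\<epsilon> / t = 1" using m(2) by linarith
  then have "\<beta> = \<alpha> m" using b unfolding \<open>\<epsilon> / t = 1\<close> by simp
  then show thesis using that m(1) by blast
qed

lemma simple_preimage:
  assumes M: "M \<subseteq> S" and y: "y \<in> W" and pos: "\<And>m. m \<in> M \<Longrightarrow> nonneg (y \<bullet> \<alpha> m)"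
    and \<beta>: "is_root \<beta>" "supp M \<beta>" and eq: "y \<bullet> \<beta> = \<alpha> k"
  obtains m where "m \<in> M" "\<beta> = \<alpha> m"
proof -
  have "nonneg \<beta>" using nonneg_act_iff[OF M y pos \<beta>(2,1)] eq by simp
  then show thesis
    using simple_of_image[OF M y, of 1 \<beta> k] pos \<beta> eq that by auto
qed

text \<open>Write the root as \<open>x \<bullet> \<alpha> i\<close> and split
  \<open>ginv x = y \<cdot> u\<close>. Then the minimal representative \<open>y\<close> sends
  \<open>u \<bullet> \<beta>\<close> to a simple root, so \<open>u \<bullet> \<beta>\<close> is a
  simple root of \<open>M\<close>. From here on, membership in a parabolic root system is checked on
  supports.\<close>

lemma roots_iff:
  assumes "M \<subseteq> S" shows "\<beta> \<in> roots \<Gamma> M \<longleftrightarrow> is_root \<beta> \<and> supp M \<beta>"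
proof
  assume "is_root \<beta> \<and> supp M \<beta>"
  then obtain x i where x: "x \<in> W" "i \<in> S" "\<beta> = x \<bullet> \<alpha> i" and \<beta>: "is_root \<beta>" "supp M \<beta>"
    unfolding is_root_def by blast
  obtain y u where y: "y \<in> W" "u \<in> parabolic \<Gamma> M" "ginv x = y \<cdot> u" "\<And>m. m \<in> M \<Longrightarrow> nonneg (y \<bullet> \<alpha> m)"
    using coset_decomposition[OF assms, of "ginv x"] x by auto
  have u: "u \<in> W" using parabolic_in_W[OF assms y(2)] .
  have "y \<bullet> u \<bullet> \<beta> = \<alpha> i" 
  proof -
    have "y \<bullet> u \<bullet> \<beta> = ginv x \<bullet> \<beta>" using y(1,3) u by (simp add: act_mult)
    then show ?thesis using x by simp
  qed
  then obtain m where "m \<in> M" "u \<bullet> \<beta> = \<alpha> m"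
    using simple_preimage[OF assms y(1,4), of "u \<bullet> \<beta>" i] is_root_act[OF \<beta>(1) u]
      supp_act[OF assms y(2) \<beta>(2)] by blast
  moreover from this have "\<beta> = ginv u \<bullet> \<alpha> m" using act_inv(1)[OF u] by metis
  ultimately show "\<beta> \<in> roots \<Gamma> M"
    unfolding roots_def using parabolic_inv[OF assms y(2)] by blast
qed (use is_root_parabolic assms in blast)

lemma roots_act: "M \<subseteq> S \<Longrightarrow> x \<in> parabolic \<Gamma> M \<Longrightarrow> \<beta> \<in> roots \<Gamma> M \<Longrightarrow> x \<bullet> \<beta> \<in> roots \<Gamma> M"
  by (simp add: roots_iff is_root_act parabolic_in_W supp_act)


section \<open>Finiteness\<close>

text \<open>The only positive root that \<open>s i\<close> makes negative is
  \<open>\<alpha> i\<close>, so each letter adds at most one inversion.\<close>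

lemma finite_inversions: "x \<in> W \<Longrightarrow> finite {\<beta>. is_root \<beta> \<and> nonneg \<beta> \<and> nonpos (x \<bullet> \<beta>)}"
proof (induction rule: W_induct)
  case one
  have "{\<beta>. is_root \<beta> \<and> nonneg \<beta> \<and> nonpos (e1 \<bullet> \<beta>)} = {}" 
    using root_not_both act_one by auto
  then show ?case by (simp only: finite.emptyI)
next
  case (snoc x i)
  let ?N = "\<lambda>x. {\<beta>. is_root \<beta> \<and> nonneg \<beta> \<and> nonpos (x \<bullet> \<beta>)}"
  have "?N (x \<cdot> s i) \<subseteq> (\<lambda>\<beta>. s i \<bullet> \<beta>) ` ?N x \<union> {\<alpha> i}"
  proof
    fix \<beta> assume b: "\<beta> \<in> ?N (x \<cdot> s i)"
    have r: "is_root (s i \<bullet> \<beta>)" using b snoc by (auto intro: is_root_act)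
    show "\<beta> \<in> (\<lambda>\<beta>. s i \<bullet> \<beta>) ` ?N x \<union> {\<alpha> i}"
    proof (cases "nonneg (s i \<bullet> \<beta>)")
      case True
      then have "s i \<bullet> \<beta> \<in> ?N x" using b snoc r by (simp add: act_mult)
      moreover have "\<beta> = s i \<bullet> s i \<bullet> \<beta>" using snoc by (simp add: act_mult[symmetric])
      ultimately show ?thesis by blast
    next
      case False
      then have n: "nonpos (s i \<bullet> \<beta>)" using root_cases r by blast
      \<comment> \<open>\<open>s i\<close> leaves the coordinate \<open>l\<close> unchanged, yet it
        is nonnegative before and nonpositive after. So \<open>\<beta>\<close> is a multiple of
        \<open>\<alpha> i\<close>.\<close>
      have "\<beta> l = 0" if "l \<noteq> i" for l
      proof -
        have "(s i \<bullet> \<beta>) l = \<beta> l" using snoc(2) that by (simp add: act_s gen_act_def simple_root_def)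
        then have "\<beta> l \<le> 0" "0 \<le> \<beta> l" using n b by (auto simp: nonpos_def nonneg_def dest: spec[of _ l])
        then show ?thesis by simp
      qed
      then have c: "\<beta> = (\<lambda>l. \<beta> i * \<alpha> i l)" by (simp add: simple_root_def fun_eq_iff)
      then have "\<beta> i = 1 \<or> \<beta> i = -1" using root_multiple[OF _ is_root_simple[OF snoc(2)], of \<beta> "\<beta> i"] b by blast
      moreover have "0 \<le> \<beta> i" using b by (auto simp: nonneg_def)
      ultimately have "\<beta> i = 1" by auto
      then have "\<beta> = \<alpha> i" using c unfolding \<open>\<beta> i = 1\<close> by simp
      then show ?thesis by blast
    qed
  qed
  then show ?case using snoc(3) finite_subset by blast
qed

lemma finite_by_action:
  assumes "finite X" "\<And>h \<beta>. h \<in> H \<Longrightarrow> \<beta> \<in> X \<Longrightarrow> h \<bullet> \<beta> \<in> X"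
    and "\<And>g h. g \<in> H \<Longrightarrow> h \<in> H \<Longrightarrow> (\<And>\<beta>. \<beta> \<in> X \<Longrightarrow> g \<bullet> \<beta> = h \<bullet> \<beta>) \<Longrightarrow> g = h"
  shows "finite H"
proof -
  let ?r = "\<lambda>h. restrict (\<lambda>\<beta>. h \<bullet> \<beta>) X"
  have "inj_on ?r H"
  proof (rule inj_onI)
    fix g h assume "g \<in> H" "h \<in> H" and e: "?r g = ?r h"
    moreover have "g \<bullet> \<beta> = h \<bullet> \<beta>" if "\<beta> \<in> X" for \<beta>
      using fun_cong[OF e, of \<beta>] that by simp
    ultimately show "g = h" using assms(3) by blast
  qed
  moreover have "?r ` H \<subseteq> X \<rightarrow>\<^sub>E X" using assms(2) by auto
  moreover have "finite (X \<rightarrow>\<^sub>E X)" using assms(1) by (intro finite_PiE) auto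
  ultimately show ?thesis using finite_imageD finite_subset by blast
qed

lemma parabolic_faithful:
  assumes "M \<subseteq> S" "g \<in> parabolic \<Gamma> M" "h \<in> parabolic \<Gamma> M" "\<And>m. m \<in> M \<Longrightarrow> g \<bullet> \<alpha> m = h \<bullet> \<alpha> m"
  shows "g = h"
proof -
  have W: "g \<in> W" "h \<in> W" using assms parabolic_in_W by auto
  have "ginv h \<cdot> g = e1"
    using assms W parabolic_mult[OF assms(1) parabolic_inv[OF assms(1,3)] assms(2)]
    by (intro parabolic_eq_one[OF assms(1)]) (auto simp: act_mult)
  then have "h \<cdot> (ginv h \<cdot> g) = h" using W by simp
  then show ?thesis using W by simp
qed

lemma finite_parabolic_of_roots: "M \<subseteq> S \<Longrightarrow> finite (roots \<Gamma> M) \<Longrightarrow> finite (parabolic \<Gamma> M)"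
proof (rule finite_by_action[of "roots \<Gamma> M"])
  fix g h
  assume M: "M \<subseteq> S" and "g \<in> parabolic \<Gamma> M" "h \<in> parabolic \<Gamma> M"
    and e: "\<And>\<beta>. \<beta> \<in> roots \<Gamma> M \<Longrightarrow> g \<bullet> \<beta> = h \<bullet> \<beta>"
  then show "g = h"
    by (intro parabolic_faithful[OF M] e) (auto simp: roots_iff is_root_simple subsetD)
qed (auto intro: roots_act)

text \<open>The finitely many roots with \<open>\<beta> a \<noteq> 0\<close> are permuted by \<open>W\<^bsub>L - a\<^esub>\<close>, and they span because
  \<open>L\<close> is connected.\<close>

lemma finite_parabolic_connected:
  assumes L: "L \<subseteq> S" "a \<in> L"
    and conn: "\<And>l. l \<in> L \<Longrightarrow> (a, l) \<in> {(i, j). i \<in> L \<and> j \<in> L \<and> adjacent \<Gamma> i j}\<^sup>*"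
    and fin: "finite {\<beta> \<in> roots \<Gamma> L. \<beta> a \<noteq> 0}"
  shows "finite (parabolic \<Gamma> L)"
proof -
  let ?X = "{\<beta> \<in> roots \<Gamma> L. \<beta> a \<noteq> 0}" and ?M = "L - {a}"
  have M: "?M \<subseteq> S" "?M \<subseteq> L" using L by auto
  have PL: "parabolic \<Gamma> ?M \<subseteq> parabolic \<Gamma> L" by (rule parabolic_mono[OF M(2)])
  have X: "h \<bullet> \<beta> \<in> ?X" if "h \<in> parabolic \<Gamma> ?M" "\<beta> \<in> ?X" for h \<beta>
    using that PL roots_act[OF L(1), of h \<beta>] act_outside[OF M(1) that(1), of a \<beta>] by auto
  have ax: "\<alpha> a \<in> ?X"
    using L by (auto simp: roots_iff is_root_simple) (auto simp: simple_root_def)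
  \<comment> \<open>The claim is made for all \<open>g\<close> at once so that it applies to the
    conjugate \<open>s k \<cdot> g \<cdot> s k\<close>, which also fixes \<open>?X\<close>
    pointwise. Hence \<open>g\<close> fixes \<open>s k \<bullet> \<alpha> l\<close>, which is
    \<open>\<alpha> l\<close> plus a nonzero multiple of \<open>\<alpha> k\<close> for adjacent
    \<open>k\<close> and \<open>l\<close>. This carries the claim along a path from
    \<open>a\<close>.\<close>
  have fixed: "\<forall>g\<in>parabolic \<Gamma> ?M. (\<forall>\<beta>\<in>?X. g \<bullet> \<beta> = \<beta>) \<longrightarrow> g \<bullet> \<alpha> l = \<alpha> l" if "l \<in> L" for l
    using conn[OF that]
  proof (induction rule: rtrancl_induct)
    case base
    then show ?case using ax by blast
  next
    case (step l k)
    have lk: "l \<in> S" "k \<in> S" "k \<in> L" "adjacent \<Gamma> l k" "l \<noteq> k" using step L by (auto simp: adjacent_def)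
    have nz: "cox_form \<Gamma> k l \<noteq> 0"
    proof -
      have "3 \<le> cox_m \<Gamma> l k" using lk by (simp add: adjacent_def)
      moreover have "cox_m \<Gamma> k l = cox_m \<Gamma> l k" using lk diagram by (simp add: is_coxeter_diagram_def)
      ultimately have m: "3 \<le> cox_m \<Gamma> k l" by simp
      show ?thesis
      proof (cases "cox_m \<Gamma> k l")
        case (enat n)
        then have "3 \<le> n" using m by (simp add: numeral_eq_enat)
        then have "pi / real n \<le> pi / 3" by (intro divide_left_mono) auto
        then have "pi / real n < pi / 2" using pi_gt_zero by linarith
        moreover have "0 < pi / real n" using \<open>3 \<le> n\<close> by simp
        ultimately have "0 < cos (pi / real n)" by (intro cos_gt_zero) auto
        then show ?thesis using enat by (simp add: cox_form_def)
      qed (simp add: cox_form_def)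
    qed
    show ?case
    proof (intro ballI impI)
      fix g assume g: "g \<in> parabolic \<Gamma> ?M" "\<forall>\<beta>\<in>?X. g \<bullet> \<beta> = \<beta>"
      have gW: "g \<in> W" using parabolic_in_W[OF M(1) g(1)] .
      show "g \<bullet> \<alpha> k = \<alpha> k"
      proof (cases "k = a")
        case True
        then show ?thesis using ax g by blast
      next
        case False
        then have sk: "s k \<in> parabolic \<Gamma> ?M" using lk(3) parabolic_gen[of k ?M] by simp
        have "s k \<cdot> g \<cdot> s k \<in> parabolic \<Gamma> ?M" using sk g parabolic_mult[OF M(1)] by blast
        moreover have "(s k \<cdot> g \<cdot> s k) \<bullet> \<beta> = \<beta>" if b: "\<beta> \<in> ?X" for \<beta>
        proof -
          have "g \<bullet> s k \<bullet> \<beta> = s k \<bullet> \<beta>" using X[OF sk b] g(2) by blast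
          then show ?thesis using gW lk by (simp add: act_mult) (simp add: act_mult[symmetric])
        qed
        ultimately have "(s k \<cdot> g \<cdot> s k) \<bullet> \<alpha> l = \<alpha> l" using step(3) by blast
        then have "s k \<bullet> g \<bullet> s k \<bullet> \<alpha> l = \<alpha> l" using gW lk by (simp add: act_mult)
        then have "g \<bullet> s k \<bullet> \<alpha> l = s k \<bullet> \<alpha> l"
          using act_inv(2)[OF s_in_W[OF lk(2)], of "g \<bullet> s k \<bullet> \<alpha> l"] inv_s[OF lk(2)] by metis
        then have "g \<bullet> (\<lambda>i. 1 * \<alpha> l i + (- 2 * cox_form \<Gamma> k l) * \<alpha> k i)
            = (\<lambda>i. 1 * \<alpha> l i + (- 2 * cox_form \<Gamma> k l) * \<alpha> k i)"
          using lk by (simp add: s_simple)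
        moreover have "g \<bullet> \<alpha> l = \<alpha> l" using step(3) g by blast
        ultimately show ?thesis unfolding act_lin[OF gW] using nz by (auto simp: fun_eq_iff)
      qed
    qed
  qed
  have "finite (parabolic \<Gamma> ?M)"
  proof (rule finite_by_action[OF fin X])
    fix g h assume gh: "g \<in> parabolic \<Gamma> ?M" "h \<in> parabolic \<Gamma> ?M" "\<And>\<beta>. \<beta> \<in> ?X \<Longrightarrow> g \<bullet> \<beta> = h \<bullet> \<beta>"
    have W: "g \<in> W" "h \<in> W" using gh parabolic_in_W[OF M(1)] by auto
    have P: "ginv h \<cdot> g \<in> parabolic \<Gamma> ?M" using gh parabolic_mult[OF M(1)] parabolic_inv[OF M(1)] by blast
    have F: "(ginv h \<cdot> g) \<bullet> \<beta> = \<beta>" if "\<beta> \<in> ?X" for \<beta>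
      using gh(3)[OF that] W by (simp add: act_mult)
    show "g = h"
    proof (rule parabolic_faithful[OF M(1) gh(1,2)])
      fix m assume "m \<in> ?M"
      then have "(ginv h \<cdot> g) \<bullet> \<alpha> m = \<alpha> m" using fixed[of m] P F by blast
      then have "h \<bullet> (ginv h \<cdot> g) \<bullet> \<alpha> m = h \<bullet> \<alpha> m" by simp
      then show "g \<bullet> \<alpha> m = h \<bullet> \<alpha> m" using W by (simp add: act_mult)
    qed
  qed
  moreover have "finite ?M" using finite_sub M by blast
  moreover have "roots \<Gamma> ?M = (\<lambda>(x, i). x \<bullet> \<alpha> i) ` (parabolic \<Gamma> ?M \<times> ?M)"
    unfolding roots_def by auto
  ultimately have "finite (roots \<Gamma> ?M)" by simp
  \<comment> \<open>A root of \<open>L\<close> with zero \<open>a\<close>-coordinate is supported on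
    \<open>?M\<close>, hence is a root of \<open>?M\<close> by \<open>roots_iff\<close>.\<close>
  moreover have "roots \<Gamma> L \<subseteq> ?X \<union> roots \<Gamma> ?M"
    by (auto simp: roots_iff[OF L(1)] roots_iff[OF M(1)] supp_def)
  ultimately have "finite (roots \<Gamma> L)" using fin finite_subset by blast
  then show ?thesis by (rule finite_parabolic_of_roots[OF L(1)])
qed


section \<open>Longest elements\<close>

lemma parabolic_root:
  assumes "M \<subseteq> S" "x \<in> parabolic \<Gamma> M" "m \<in> M"
  shows "is_root (x \<bullet> \<alpha> m)" "supp M (x \<bullet> \<alpha> m)"
  using assms is_root_act[OF is_root_simple parabolic_in_W] supp_act by auto

lemma negating_flips:
  assumes "M \<subseteq> S" "w \<in> W" "\<And>m. m \<in> M \<Longrightarrow> nonpos (w \<bullet> \<alpha> m)" "supp M \<beta>"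
  shows "nonneg \<beta> \<Longrightarrow> nonpos (w \<bullet> \<beta>)" "nonpos \<beta> \<Longrightarrow> nonneg (w \<bullet> \<beta>)"
proof -
  have e: "w \<bullet> \<beta> = (\<lambda>k. \<Sum>m\<in>M. \<beta> m * (w \<bullet> \<alpha> m) k)"
    by (rule act_expand[OF assms(2) finite_sub[OF assms(1)] assms(4)])
  show "nonpos (w \<bullet> \<beta>)" if "nonneg \<beta>"
    unfolding e nonpos_def using that assms(3)
    by (intro allI sum_nonpos mult_nonneg_nonpos) (auto simp: nonneg_def nonpos_def)
  show "nonneg (w \<bullet> \<beta>)" if "nonpos \<beta>"
    unfolding e nonneg_def using that assms(3)
    by (intro allI sum_nonneg mult_nonpos_nonpos) (auto simp: nonpos_def)
qed

lemma negating_inv: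
  assumes "M \<subseteq> S" "w \<in> parabolic \<Gamma> M" "\<And>m. m \<in> M \<Longrightarrow> nonpos (w \<bullet> \<alpha> m)" "m \<in> M"
  shows "nonpos (ginv w \<bullet> \<alpha> m)"
proof -
  have w: "w \<in> W" using assms parabolic_in_W by blast
  note r = parabolic_root[OF assms(1) parabolic_inv[OF assms(1,2)] assms(4)]
  have "\<not> nonneg (ginv w \<bullet> \<alpha> m)"
    using negating_flips(1)[OF assms(1) w assms(3) r(2)] w by auto
  then show ?thesis using root_cases[OF r(1)] by blast
qed

text \<open>Both \<open>w\<close> and \<open>ginv u\<close> exchange positive and negative roots of
  \<open>M\<close>, so \<open>w \<cdot> ginv u\<close> keeps the simple roots of \<open>M\<close>
  positive and is trivial.\<close>

lemma negating_unique:
  assumes M: "M \<subseteq> S" and w: "w \<in> parabolic \<Gamma> M" "\<And>m. m \<in> M \<Longrightarrow> nonpos (w \<bullet> \<alpha> m)"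
    and u: "u \<in> parabolic \<Gamma> M" "\<And>m. m \<in> M \<Longrightarrow> nonpos (u \<bullet> \<alpha> m)"
  shows "w = u"
proof -
  have W: "w \<in> W" "u \<in> W" using M w(1) u(1) parabolic_in_W by auto
  have "w \<cdot> ginv u = e1"
  proof (rule parabolic_eq_one[OF M])
    show "w \<cdot> ginv u \<in> parabolic \<Gamma> M" using parabolic_mult[OF M w(1)] parabolic_inv[OF M u(1)] by blast
    fix m assume m: "m \<in> M"
    have "nonneg (w \<bullet> ginv u \<bullet> \<alpha> m)"
      using negating_flips(2)[OF M W(1) w(2)] negating_inv[OF M u m]
        parabolic_root(2)[OF M parabolic_inv[OF M u(1)] m] by blast
    then show "nonneg ((w \<cdot> ginv u) \<bullet> \<alpha> m)" using W by (simp add: act_mult)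
  qed
  then have "w \<cdot> ginv u \<cdot> u = u" using W by simp
  then show ?thesis using W by simp
qed

text \<open>An element of maximal length has every \<open>m \<in> M\<close> as a right descent and
  therefore negates all simple roots of \<open>M\<close>. Only one element does that, so the
  definite description in \<open>longest\<close> denotes it.\<close>

lemma longest:
  assumes M: "M \<subseteq> S" and fin: "finite (parabolic \<Gamma> M)"
  shows "longest \<Gamma> M \<in> parabolic \<Gamma> M" "m \<in> M \<Longrightarrow> nonpos (longest \<Gamma> M \<bullet> \<alpha> m)"
proof -
  let ?P = "\<lambda>w. w \<in> parabolic \<Gamma> M \<and> (\<forall>u\<in>parabolic \<Gamma> M. len u \<le> len w)"
  have neg: "nonpos (w \<bullet> \<alpha> m)" if w: "?P w" and m: "m \<in> M" for w m
  proof -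
    have *: "w \<in> W" "m \<in> S" using that M parabolic_in_W by auto
    have "len (w \<cdot> s m) \<le> len w" using w parabolic_mult[OF M _ parabolic_gen[OF m], of w] by simp
    then have "len w = len (w \<cdot> s m) + 1" using length_mult_s[OF *] by linarith
    then show ?thesis using descent_iff[OF *] by blast
  qed
  have "parabolic \<Gamma> M \<noteq> {}" using parabolic_one[OF M] by blast
  then have "Max (len ` parabolic \<Gamma> M) \<in> len ` parabolic \<Gamma> M" using fin by (intro Max_in) auto
  then obtain w where w: "w \<in> parabolic \<Gamma> M" "Max (len ` parabolic \<Gamma> M) = len w" by blast
  then have "?P w" using Max_ge[OF finite_imageI[OF fin, of len]] by auto
  then have "\<exists>!w. ?P w" using negating_unique[OF M] neg by blast
  then have "?P (longest \<Gamma> M)" unfolding longest_def by (rule theI')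
  then show "longest \<Gamma> M \<in> parabolic \<Gamma> M" "m \<in> M \<Longrightarrow> nonpos (longest \<Gamma> M \<bullet> \<alpha> m)" using neg by auto
qed

lemma longest_inv:
  assumes "M \<subseteq> S" "finite (parabolic \<Gamma> M)" shows "ginv (longest \<Gamma> M) = longest \<Gamma> M"
  using negating_unique[OF assms(1) parabolic_inv[OF assms(1) longest(1)[OF assms]] _ longest[OF assms]]
    negating_inv[OF assms(1) longest[OF assms]] by blast

lemma longest_act2:
  assumes "M \<subseteq> S" "finite (parabolic \<Gamma> M)" shows "longest \<Gamma> M \<bullet> longest \<Gamma> M \<bullet> v = v"
  using act_inv(1)[OF parabolic_in_W[OF assms(1) longest(1)[OF assms]]] longest_inv[OF assms] by simp

text \<open>The negative of \<open>longest \<Gamma> M \<bullet> \<alpha> k\<close> is a positive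
  root that the longest element sends to the negative of \<open>\<alpha> k\<close>; extremality of
  \<open>\<alpha> k\<close> makes it simple.\<close>

lemma opposition:
  assumes M: "M \<subseteq> S" and fin: "finite (parabolic \<Gamma> M)" and k: "k \<in> M"
  shows "opposition \<Gamma> M k \<in> M" "longest \<Gamma> M \<bullet> \<alpha> k = (\<lambda>i. - \<alpha> (opposition \<Gamma> M k) i)"
proof -
  let ?w = "longest \<Gamma> M" and ?P = "\<lambda>j. j \<in> M \<and> longest \<Gamma> M \<bullet> \<alpha> k = (\<lambda>i. - \<alpha> j i)"
  note w = longest[OF M fin]
  have W: "?w \<in> W" using parabolic_in_W[OF M w(1)] .
  let ?\<beta> = "\<lambda>i. - (?w \<bullet> \<alpha> k) i"
  have r: "is_root ?\<beta>" "supp M ?\<beta>"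
    using parabolic_root[OF M w(1) k] is_root_minus by (auto simp: supp_def)
  have n: "nonneg ?\<beta>" using w(2)[OF k] by simp
  have "?w \<bullet> ?\<beta> = (\<lambda>i. - \<alpha> k i)" using act_minus[OF W] longest_act2[OF M fin] by simp
  then have "-1 * (?w \<bullet> ?\<beta>) l = \<alpha> k l" for l by simp
  then obtain m where "m \<in> M" "?\<beta> = \<alpha> m"
    using simple_of_image[OF M W, of "-1" ?\<beta> k] r n w(2) by auto
  then have "?P m" by (auto simp: fun_eq_iff) (metis minus_minus)
  moreover have "j = m" if "?P j" for j
  proof -
    have "- \<alpha> j i = - \<alpha> m i" for i using that \<open>?P m\<close> by metis
    then show ?thesis using simple_inj[of j m] by auto
  qed
  ultimately have "?P (opposition \<Gamma> M k)" unfolding opposition_def by (rule theI)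
  then show "opposition \<Gamma> M k \<in> M" "longest \<Gamma> M \<bullet> \<alpha> k = (\<lambda>i. - \<alpha> (opposition \<Gamma> M k) i)" by auto
qed

lemma opposition_twice:
  assumes M: "M \<subseteq> S" and fin: "finite (parabolic \<Gamma> M)" and k: "k \<in> M"
  shows "opposition \<Gamma> M (opposition \<Gamma> M k) = k"
proof -
  have W: "longest \<Gamma> M \<in> W" using parabolic_in_W[OF M longest(1)[OF M fin]] .
  have "\<alpha> k = longest \<Gamma> M \<bullet> longest \<Gamma> M \<bullet> \<alpha> k" using longest_act2[OF M fin] by simp
  also have "\<dots> = \<alpha> (opposition \<Gamma> M (opposition \<Gamma> M k))"
    using opposition(2)[OF M fin k] opposition(2)[OF M fin opposition(1)[OF M fin k]] act_minus[OF W] by simp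
  finally show ?thesis using simple_inj by metis
qed

lemma opposition_image:
  assumes M: "M \<subseteq> S" and fin: "finite (parabolic \<Gamma> M)" and N: "N \<subseteq> M"
  shows "opposition \<Gamma> M ` (M - N) = M - opposition \<Gamma> M ` N"
proof -
  have "inj_on (opposition \<Gamma> M) M"
    by (rule inj_on_inverseI[of _ "opposition \<Gamma> M"]) (rule opposition_twice[OF M fin])
  moreover have "opposition \<Gamma> M ` M = M"
    using opposition(1)[OF M fin] opposition_twice[OF M fin] by (metis image_subset_iff subsetI subset_antisym imageI)
  ultimately show ?thesis using N by (simp add: inj_on_image_set_diff[of _ M])
qed


section \<open>Morphisms\<close>

text \<open>\<open>bh_hom\<close> without the reference to \<open>J\<close>: being an associate is
  carried along such elements by \<open>mor_associates\<close>, so it need not accompany every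
  computation.\<close>

definition mor :: "'a list set \<Rightarrow> 'a set \<Rightarrow> 'a set \<Rightarrow> bool" where
  "mor x I K \<longleftrightarrow> x \<in> W \<and> I \<subseteq> S \<and> K \<subseteq> S \<and> \<alpha> ` I = (\<lambda>k. x \<bullet> \<alpha> k) ` K"

lemma mor_in_W: "mor x I K \<Longrightarrow> x \<in> W"
  by (simp add: mor_def)

lemma mor_one: "I \<subseteq> S \<Longrightarrow> mor e1 I I"
  by (simp add: mor_def)

lemma mor_inv:
  assumes "mor x I K" shows "mor (ginv x) K I"
proof -
  have "(\<lambda>i. ginv x \<bullet> \<alpha> i) ` I = (\<lambda>v. ginv x \<bullet> v) ` \<alpha> ` I" by (simp add: image_image)
  also have "\<dots> = \<alpha> ` K" using assms by (simp add: mor_def image_image)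
  finally show ?thesis using assms by (simp add: mor_def)
qed

lemma mor_mult:
  assumes "mor x I K" "mor y K L" shows "mor (x \<cdot> y) I L"
proof -
  have "(\<lambda>k. (x \<cdot> y) \<bullet> \<alpha> k) ` L = (\<lambda>v. x \<bullet> v) ` (\<lambda>k. y \<bullet> \<alpha> k) ` L"
    using assms by (simp add: image_image act_mult mor_in_W)
  moreover have "(\<lambda>k. y \<bullet> \<alpha> k) ` L = \<alpha> ` K" using assms by (simp add: mor_def)
  ultimately have "(\<lambda>k. (x \<cdot> y) \<bullet> \<alpha> k) ` L = \<alpha> ` I" using assms by (simp add: mor_def image_image)
  then show ?thesis using assms by (simp add: mor_def)
qed

lemma mor_E:
  assumes "mor x I K" "i \<in> I" obtains k where "k \<in> K" "ginv x \<bullet> \<alpha> i = \<alpha> k"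
proof -
  have "ginv x \<bullet> \<alpha> i \<in> \<alpha> ` K" using mor_inv[OF assms(1)] assms(2) by (auto simp: mor_def)
  then show thesis using that by blast
qed

text \<open>By \<open>conj_gen\<close>, conjugation by \<open>ginv x\<close> maps the simple
  generators of \<open>I\<close> onto those of \<open>K\<close>.\<close>

lemma mor_parabolic:
  assumes "mor x I K" shows "parabolic \<Gamma> K = (\<lambda>h. ginv x \<cdot> h \<cdot> x) ` parabolic \<Gamma> I"
proof -
  let ?c = "\<lambda>h. ginv x \<cdot> h \<cdot> x"
  have x: "x \<in> W" using assms mor_in_W by blast
  interpret c: group_hom "cox_group \<Gamma>" "cox_group \<Gamma>" ?c
    by unfold_locales (use x in \<open>auto simp: hom_def m_assoc\<close>)
  have I: "I \<subseteq> S" "K \<subseteq> S" using assms by (auto simp: mor_def)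
  have "s k \<in> ?c ` s ` I" if "k \<in> K" for k
  proof -
    obtain i where "i \<in> I" "x \<bullet> \<alpha> k = \<alpha> i" using assms \<open>k \<in> K\<close> by (auto simp: mor_def) (metis imageE imageI)
    moreover from this have "ginv x \<bullet> \<alpha> i = \<alpha> k" using x by (metis act_inv(1))
    ultimately have "?c (s i) = s k"
      using conj_gen[of "ginv x" i k] x I that by auto
    then show ?thesis using \<open>i \<in> I\<close> by blast
  qed
  moreover have "?c (s i) \<in> s ` K" if "i \<in> I" for i
  proof -
    obtain k where "k \<in> K" "ginv x \<bullet> \<alpha> i = \<alpha> k" using mor_E[OF assms \<open>i \<in> I\<close>] by blast
    then show ?thesis using conj_gen[of "ginv x" i k] x I \<open>i \<in> I\<close> by auto
  qed
  ultimately have "s ` K = ?c ` s ` I" by auto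
  then show ?thesis unfolding parabolic_def
    using c.generate_img[of "s ` I"] I by (metis image_subset_iff s_in_W subsetD)
qed

lemma mor_associates:
  assumes "mor x I K" "I \<in> associates \<Gamma> J" "J \<subseteq> S" shows "K \<in> associates \<Gamma> J"
proof -
  obtain g where g: "g \<in> W" "parabolic \<Gamma> I = (\<lambda>h. g \<cdot> h \<cdot> ginv g) ` parabolic \<Gamma> J"
    using assms(2) by (auto simp: associates_def)
  have x: "x \<in> W" using assms mor_in_W by blast
  have "parabolic \<Gamma> K = (\<lambda>h. (ginv x \<cdot> g) \<cdot> h \<cdot> ginv (ginv x \<cdot> g)) ` parabolic \<Gamma> J"
    unfolding mor_parabolic[OF assms(1)] g(2) image_image
    using x g(1) parabolic_in_W[OF assms(3)] by (intro image_cong) (auto simp: m_assoc inv_mult)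
  then show ?thesis using assms(1) x g(1) by (auto simp: associates_def mor_def intro!: bexI[of _ "ginv x \<cdot> g"])
qed

lemma bh_hom_iff: "x \<in> bh_hom \<Gamma> J I K \<longleftrightarrow> I \<in> associates \<Gamma> J \<and> K \<in> associates \<Gamma> J \<and> mor x I K"
  by (auto simp: bh_hom_def mor_def associates_def)

text \<open>Modulo the span of \<open>\<alpha>\<^sub>k\<close>, \<open>k \<in> K\<close>, the vector \<open>x\<^sup>-\<^sup>1 \<bullet> \<beta>\<close> is a nonnegative combination of the
  nonpositive vectors \<open>x\<^sup>-\<^sup>1 \<bullet> \<alpha>\<^sub>t\<close>, \<open>t \<in> T - I\<close>.\<close>

lemma mor_nonpos:
  assumes x: "mor x I K" and T: "I \<subseteq> T" "T \<subseteq> S" "\<And>t. t \<in> T - I \<Longrightarrow> nonpos (ginv x \<bullet> \<alpha> t)"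
    and \<beta>: "is_root \<beta>" "supp T \<beta>" "nonneg \<beta>" "\<not> supp I \<beta>"
  shows "nonpos (ginv x \<bullet> \<beta>)"
proof (rule ccontr)
  assume "\<not> nonpos (ginv x \<bullet> \<beta>)"
  have xW: "x \<in> W" using x mor_in_W by blast
  have n: "nonneg (ginv x \<bullet> \<beta>)"
    using \<open>\<not> nonpos _\<close> root_cases is_root_act[OF \<beta>(1)] xW by blast
  \<comment> \<open>Off \<open>K\<close> the images of the simple roots of \<open>I\<close> have
    coordinate \<open>0\<close> and those of the others are nonpositive, while the whole vector is
    assumed nonnegative.\<close>
  have "(ginv x \<bullet> \<beta>) l = 0" if l: "l \<notin> K" for l
  proof -
    have "(ginv x \<bullet> \<beta>) l = (\<Sum>t\<in>T. \<beta> t * (ginv x \<bullet> \<alpha> t) l)"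
      using act_expand[OF _ finite_sub[OF T(2)] \<beta>(2)] xW by auto
    also have "\<dots> \<le> 0"
    proof (rule sum_nonpos)
      fix t assume t: "t \<in> T"
      have "(ginv x \<bullet> \<alpha> t) l \<le> 0"
      proof (cases "t \<in> I")
        case True
        then obtain k where "k \<in> K" "ginv x \<bullet> \<alpha> t = \<alpha> k" using mor_E[OF x] by blast
        then show ?thesis using l by (auto simp: simple_root_def)
      next
        case False
        then show ?thesis using T(3)[of t] t by (auto simp: nonpos_def)
      qed
      then show "\<beta> t * (ginv x \<bullet> \<alpha> t) l \<le> 0"
        using \<beta>(3) by (auto simp: nonneg_def intro: mult_nonneg_nonpos)
    qed
    finally show ?thesis using n unfolding nonneg_def by (metis order.antisym)
  qed
  \<comment> \<open>Applying \<open>x\<close> to a vector supported on \<open>K\<close> gives one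
    supported on \<open>I\<close>, contrary to the assumption on \<open>\<beta>\<close>.\<close>
  then have "supp K (ginv x \<bullet> \<beta>)" by (simp add: supp_def)
  moreover have "x \<bullet> ginv x \<bullet> \<beta> = \<beta>" using xW by simp
  ultimately have e: "\<beta> = (\<lambda>l. \<Sum>k\<in>K. (ginv x \<bullet> \<beta>) k * (x \<bullet> \<alpha> k) l)"
    using act_expand[OF xW, of K] x finite_sub[of K] by (metis mor_def)
  have "\<beta> l = 0" if "l \<notin> I" for l
  proof -
    have "(x \<bullet> \<alpha> k) l = 0" if "k \<in> K" for k
    proof -
      have "x \<bullet> \<alpha> k \<in> \<alpha> ` I" using x that by (auto simp: mor_def)
      then show ?thesis using \<open>l \<notin> I\<close> by (auto simp: simple_root_def)
    qed
    then show ?thesis using fun_cong[OF e, of l] by simp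
  qed
  then show False using \<beta>(4) by (simp add: supp_def)
qed

lemma mor_nonneg:
  assumes x: "mor x I K" and \<beta>: "supp I \<beta>" "nonneg \<beta>"
  shows "nonneg (ginv x \<bullet> \<beta>)"
proof (rule nonneg_act[of I])
  fix i assume "i \<in> I"
  then show "nonneg (ginv x \<bullet> \<alpha> i)" using mor_E[OF x] by (metis nonneg_simple)
qed (use x \<beta> in \<open>auto simp: mor_def\<close>)


section \<open>The elements \<open>v\<^bsub>a,I\<^esub>\<close>\<close>

context
  fixes I :: "'a set" and a :: 'a
  assumes I: "I \<subseteq> S" and a: "a \<in> S - I"
begin

abbreviation "L \<equiv> component \<Gamma> I a"

lemma component_step: "l \<in> L \<Longrightarrow> l \<in> insert a I \<Longrightarrow> k \<in> insert a I \<Longrightarrow> adjacent \<Gamma> l k \<Longrightarrow> k \<in> L"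
  unfolding component_def by (auto intro: rtrancl_into_rtrancl)

lemma component_base: "a \<in> L"
  by (simp add: component_def)

lemma component_sub: "L \<subseteq> insert a I"
proof
  fix l assume "l \<in> L"
  then have "(a, l) \<in> {(i, j). i \<in> insert a I \<and> j \<in> insert a I \<and> adjacent \<Gamma> i j}\<^sup>*"
    by (simp add: component_def)
  then show "l \<in> insert a I" by (induction rule: rtrancl_induct) auto
qed

lemma component_S: "L \<subseteq> S"
  using component_sub I a by blast

lemma component_path: "l \<in> L \<Longrightarrow> (a, l) \<in> {(i, j). i \<in> L \<and> j \<in> L \<and> adjacent \<Gamma> i j}\<^sup>*"
proof -
  assume "l \<in> L"
  then have "(a, l) \<in> {(i, j). i \<in> insert a I \<and> j \<in> insert a I \<and> adjacent \<Gamma> i j}\<^sup>*"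
    by (simp add: component_def)
  then have "l \<in> L \<and> (a, l) \<in> {(i, j). i \<in> L \<and> j \<in> L \<and> adjacent \<Gamma> i j}\<^sup>*"
  proof (induction rule: rtrancl_induct)
    case base
    then show ?case by (simp add: component_base)
  next
    case (step l k)
    then have "k \<in> L" using component_step by auto
    then show ?case using step by (auto intro: rtrancl_into_rtrancl)
  qed
  then show ?thesis by blast
qed

text \<open>No vertex of \<open>I - L\<close> is adjacent to a vertex of \<open>L\<close>, so the
  form vanishes between them.\<close>

lemma component_fix: "x \<in> parabolic \<Gamma> L \<Longrightarrow> i \<in> I - L \<Longrightarrow> x \<bullet> \<alpha> i = \<alpha> i"
proof (induction rule: parabolic_induct[OF component_S, consumes 1, case_names one snoc])
  case one
  then show ?case by simp
next
  case (snoc x l)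
  have lS: "l \<in> S" "i \<in> S" "x \<in> W" using snoc component_S I parabolic_in_W[OF component_S] by auto
  have ne: "l \<noteq> i" using snoc by auto
  have "\<not> adjacent \<Gamma> l i" using snoc component_step component_sub by blast
  then have "\<not> 3 \<le> cox_m \<Gamma> l i" using ne by (simp add: adjacent_def)
  moreover have "2 \<le> cox_m \<Gamma> l i" using ne lS diagram by (simp add: is_coxeter_diagram_def)
  ultimately have "cox_m \<Gamma> l i = enat 2"
    by (cases "cox_m \<Gamma> l i") (auto simp: numeral_eq_enat)
  then have "cox_form \<Gamma> l i = 0" by (simp add: cox_form_def)
  then have "s l \<bullet> \<alpha> i = \<alpha> i" using lS by (simp add: s_simple)
  then show ?case using snoc lS by (simp add: act_mult)
qed

context
  assumes fin: "finite (parabolic \<Gamma> L)"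
begin

lemma component_minus_S: "L - {a} \<subseteq> S"
  using component_S by blast

lemma finite_parabolic_minus: "finite (parabolic \<Gamma> (L - {a}))"
  by (rule finite_subset[OF parabolic_mono fin]) blast

lemma longest_minus_parabolic: "longest \<Gamma> (L - {a}) \<in> parabolic \<Gamma> L"
  using longest(1)[OF component_minus_S finite_parabolic_minus] parabolic_mono[of "L - {a}" L] by blast

lemma longest_W: "longest \<Gamma> L \<in> W" "longest \<Gamma> (L - {a}) \<in> W"
  using parabolic_in_W component_S component_minus_S longest(1)[OF component_minus_S finite_parabolic_minus] longest(1)[OF component_S fin] by blast+

lemma bh_v_parabolic: "bh_v \<Gamma> a I \<in> parabolic \<Gamma> L"
  unfolding bh_v_def
  using parabolic_mult[OF component_S longest_minus_parabolic longest(1)[OF component_S fin]] .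

lemma bh_v_W: "bh_v \<Gamma> a I \<in> W"
  using parabolic_in_W[OF component_S bh_v_parabolic] .

lemma bh_v_inv: "ginv (bh_v \<Gamma> a I) = longest \<Gamma> L \<cdot> longest \<Gamma> (L - {a})"
  unfolding bh_v_def using longest_W longest_inv[OF component_S fin] longest_inv[OF component_minus_S finite_parabolic_minus]
  by (simp add: inv_mult)

lemma bh_v_inv_act:
  assumes "l \<in> L - {a}"
  shows "ginv (bh_v \<Gamma> a I) \<bullet> \<alpha> l = \<alpha> (opposition \<Gamma> L (opposition \<Gamma> (L - {a}) l))"
proof -
  have "opposition \<Gamma> (L - {a}) l \<in> L" using opposition(1)[OF component_minus_S finite_parabolic_minus assms] by blast
  then show ?thesis
    unfolding bh_v_inv using longest_W opposition(2)[OF component_minus_S finite_parabolic_minus assms]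
      opposition(2)[OF component_S fin] by (simp add: act_mult act_minus)
qed

text \<open>An element of the parabolic subgroup of \<open>L - {a}\<close> cannot change the
  \<open>a\<close>-coordinate, which is \<open>1\<close> for \<open>\<alpha> a\<close>; one positive
  coordinate makes the whole root positive.\<close>

lemma longest_minus_a:
  "is_root (longest \<Gamma> (L - {a}) \<bullet> \<alpha> a)" "supp L (longest \<Gamma> (L - {a}) \<bullet> \<alpha> a)"
  "(longest \<Gamma> (L - {a}) \<bullet> \<alpha> a) a = 1" "nonneg (longest \<Gamma> (L - {a}) \<bullet> \<alpha> a)"
proof -
  show r: "is_root (longest \<Gamma> (L - {a}) \<bullet> \<alpha> a)" "supp L (longest \<Gamma> (L - {a}) \<bullet> \<alpha> a)"
    using parabolic_root[OF component_S longest_minus_parabolic component_base] by auto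
  show c: "(longest \<Gamma> (L - {a}) \<bullet> \<alpha> a) a = 1"
    using act_outside[OF component_minus_S longest(1)[OF component_minus_S finite_parabolic_minus], of a] by (simp add: simple_root_def)
  then have "\<not> nonpos (longest \<Gamma> (L - {a}) \<bullet> \<alpha> a)"
    by (auto simp: nonpos_def intro!: exI[of _ a])
  then show "nonneg (longest \<Gamma> (L - {a}) \<bullet> \<alpha> a)" using root_cases r by blast
qed

lemma bh_v_inv_a: "nonpos (ginv (bh_v \<Gamma> a I) \<bullet> \<alpha> a)"
  unfolding bh_v_inv
  using negating_flips(1)[OF component_S longest_W(1) longest(2)[OF component_S fin] longest_minus_a(2,4)]
    longest_W by (simp add: act_mult)

text \<open>The inverse is followed on simple roots. On \<open>L - {a}\<close> it is the opposition
  of \<open>L - {a}\<close> followed by that of \<open>L\<close>, with image \<open>L\<close> minus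
  the opposite of \<open>a\<close>; on \<open>I - L\<close> it is the identity.\<close>

lemma mor_bh_v: "mor (bh_v \<Gamma> a I) I (bh_v_target \<Gamma> a I)"
proof -
  let ?v = "ginv (bh_v \<Gamma> a I)" and ?\<iota> = "opposition \<Gamma> L"
  have vL: "?v \<in> parabolic \<Gamma> L" using parabolic_inv[OF component_S bh_v_parabolic] .
  have split: "I = (L - {a}) \<union> (I - L)" "insert a I = L \<union> (I - L)"
    using component_sub component_base a by auto
  have "(\<lambda>i. ?v \<bullet> \<alpha> i) ` (L - {a}) = \<alpha> ` ?\<iota> ` opposition \<Gamma> (L - {a}) ` (L - {a})"
    using bh_v_inv_act by (simp add: image_image)
  also have "opposition \<Gamma> (L - {a}) ` (L - {a}) = L - {a}"
    using opposition_image[OF component_minus_S finite_parabolic_minus, of "{}"] by simp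
  also have "?\<iota> ` (L - {a}) = L - {?\<iota> a}"
    using opposition_image[OF component_S fin, of "{a}"] component_base by simp
  finally have 1: "(\<lambda>i. ?v \<bullet> \<alpha> i) ` (L - {a}) = \<alpha> ` (L - {?\<iota> a})" .
  have 2: "(\<lambda>i. ?v \<bullet> \<alpha> i) ` (I - L) = \<alpha> ` (I - L)"
    using component_fix[OF vL] by (intro image_cong) auto
  have "(\<lambda>i. ?v \<bullet> \<alpha> i) ` I = (\<lambda>i. ?v \<bullet> \<alpha> i) ` (L - {a}) \<union> (\<lambda>i. ?v \<bullet> \<alpha> i) ` (I - L)"
    by (subst split(1)) (rule image_Un)
  also have "\<dots> = \<alpha> ` ((L - {?\<iota> a}) \<union> (I - L))" unfolding 1 2 by (rule image_Un[symmetric])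
  also have "(L - {?\<iota> a}) \<union> (I - L) = bh_v_target \<Gamma> a I"
    unfolding bh_v_target_def split(2) using opposition(1)[OF component_S fin component_base] by blast
  finally have "mor ?v (bh_v_target \<Gamma> a I) I"
    using bh_v_W I a by (auto simp: mor_def bh_v_target_def)
  then show ?thesis using mor_inv bh_v_W by fastforce
qed

end

text \<open>By \<open>mor_nonpos\<close>, every positive root of \<open>L\<close> with nonzero
  \<open>a\<close>-coordinate is an inversion of \<open>ginv x\<close>. There are finitely many of
  these, and up to sign they are all that \<open>finite_parabolic_connected\<close> asks
  about.\<close>

lemma finite_component:
  assumes x: "mor x I K" and neg: "nonpos (ginv x \<bullet> \<alpha> a)"
  shows "finite (parabolic \<Gamma> L)"
proof (rule finite_parabolic_connected[OF component_S component_base component_path])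
  let ?N = "{\<beta>. is_root \<beta> \<and> nonneg \<beta> \<and> nonpos (ginv x \<bullet> \<beta>)}"
  have xW: "ginv x \<in> W" using x mor_in_W by blast
  have N: "\<beta> \<in> ?N" if b: "\<beta> \<in> roots \<Gamma> L" "\<beta> a \<noteq> 0" "nonneg \<beta>" for \<beta>
  proof -
    have r: "is_root \<beta>" "supp L \<beta>" using b(1) roots_iff[OF component_S] by auto
    have "nonpos (ginv x \<bullet> \<beta>)"
    proof (rule mor_nonpos[OF x, of "insert a I"])
      show "\<not> supp I \<beta>" using b(2) a by (auto simp: supp_def)
      show "supp (insert a I) \<beta>" using supp_mono[OF r(2) component_sub] .
    qed (use I a neg r b in auto)
    then show ?thesis using r b by blast
  qed
  have "{\<beta> \<in> roots \<Gamma> L. \<beta> a \<noteq> 0} \<subseteq> ?N \<union> (\<lambda>\<beta> k. - \<beta> k) ` ?N"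
  proof
    fix \<beta> assume b: "\<beta> \<in> {\<beta> \<in> roots \<Gamma> L. \<beta> a \<noteq> 0}"
    then have r: "is_root \<beta>" "supp L \<beta>" "\<beta> a \<noteq> 0" using roots_iff[OF component_S] by auto
    show "\<beta> \<in> ?N \<union> (\<lambda>\<beta> k. - \<beta> k) ` ?N"
    proof (cases "nonneg \<beta>")
      case True
      then show ?thesis using N b by blast
    next
      case False
      then have "nonneg (\<lambda>k. - \<beta> k)" using root_cases[OF r(1)] by simp
      moreover have "(\<lambda>k. - \<beta> k) \<in> roots \<Gamma> L"
        using r is_root_minus by (simp add: roots_iff[OF component_S] supp_def)
      ultimately have "(\<lambda>k. - \<beta> k) \<in> ?N" using N r(3) by simp
      then show ?thesis by (intro UnI2 rev_image_eqI[of "\<lambda>k. - \<beta> k"]) auto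
    qed
  qed
  then show "finite {\<beta> \<in> roots \<Gamma> L. \<beta> a \<noteq> 0}"
    using finite_inversions[OF xW] finite_subset by blast
qed

text \<open>It suffices that \<open>z = ginv x \<cdot> bh_v \<Gamma> a I\<close> keeps the simple
  roots of \<open>L\<close> positive: then \<open>length_add\<close> applies to
  \<open>ginv x\<close>, the product of \<open>z\<close> and the inverse of
  \<open>bh_v \<Gamma> a I\<close>.\<close>

lemma bh_v_prefix:
  assumes x: "mor x I K" and neg: "nonpos (ginv x \<bullet> \<alpha> a)"
  shows "len x = len (bh_v \<Gamma> a I) + len (ginv (bh_v \<Gamma> a I) \<cdot> x)"
proof -
  note fin = finite_component[OF x neg]
  let ?v = "bh_v \<Gamma> a I"
  have xW: "x \<in> W" using x mor_in_W by blast
  have vW: "?v \<in> W" using bh_v_W[OF fin] .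
  define z where "z = ginv x \<cdot> ?v"
  have zW: "z \<in> W" using xW vW by (simp add: z_def)
  have pos: "nonneg (z \<bullet> \<alpha> l)" if l: "l \<in> L" for l
  proof -
    let ?M = "L - {a}"
    have z: "z \<bullet> \<alpha> l = ginv x \<bullet> longest \<Gamma> ?M \<bullet> longest \<Gamma> L \<bullet> \<alpha> l"
      unfolding z_def bh_v_def using xW longest_W[OF fin] by (simp add: act_mult)
    \<comment> \<open>The longest element of \<open>L\<close> turns \<open>\<alpha> l\<close> into
      the negative of \<open>\<alpha> j\<close>. For \<open>j = a\<close> the next factor gives the
      negative of a positive root with \<open>a\<close>-coordinate \<open>1\<close>, which
      \<open>ginv x\<close> makes positive. Otherwise a second sign change leaves a simple root of
      \<open>I\<close>, which the morphism keeps positive.\<close>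
    define j where "j = opposition \<Gamma> L l"
    have j: "j \<in> L" "longest \<Gamma> L \<bullet> \<alpha> l = (\<lambda>k. - \<alpha> j k)"
      unfolding j_def using opposition[OF component_S fin l] by auto
    have zj: "z \<bullet> \<alpha> l = (\<lambda>k. - (ginv x \<bullet> longest \<Gamma> ?M \<bullet> \<alpha> j) k)"
      unfolding z j(2) using xW longest_W[OF fin] by (simp add: act_minus)
    show ?thesis
    proof (cases "j = a")
      case True
      have "nonpos (ginv x \<bullet> longest \<Gamma> ?M \<bullet> \<alpha> a)"
      proof (rule mor_nonpos[OF x, of "insert a I"])
        show "\<not> supp I (longest \<Gamma> ?M \<bullet> \<alpha> a)" using longest_minus_a(3)[OF fin] a by (auto simp: supp_def)
        show "supp (insert a I) (longest \<Gamma> ?M \<bullet> \<alpha> a)"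
          using supp_mono[OF longest_minus_a(2)[OF fin] component_sub] .
      qed (use I a neg longest_minus_a[OF fin] in auto)
      then show ?thesis using zj True by simp
    next
      case False
      then have jM: "j \<in> ?M" using j by blast
      have "longest \<Gamma> ?M \<bullet> \<alpha> j = (\<lambda>k. - \<alpha> (opposition \<Gamma> ?M j) k)"
        using opposition(2)[OF component_minus_S[OF fin] finite_parabolic_minus[OF fin] jM] .
      then have "z \<bullet> \<alpha> l = ginv x \<bullet> \<alpha> (opposition \<Gamma> ?M j)" using zj xW by (simp add: act_minus)
      moreover have "opposition \<Gamma> ?M j \<in> I"
        using opposition(1)[OF component_minus_S[OF fin] finite_parabolic_minus[OF fin] jM] component_sub by blast
      ultimately show ?thesis using mor_nonneg[OF x, of "\<alpha> (opposition \<Gamma> ?M j)"] by simp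
    qed
  qed
  have "len (z \<cdot> ginv ?v) = len z + len (ginv ?v)"
    by (rule length_add[OF component_S zW pos parabolic_inv[OF component_S bh_v_parabolic[OF fin]]])
  moreover have "z \<cdot> ginv ?v = ginv x" using xW vW by (simp add: z_def)
  moreover have "z = ginv (ginv ?v \<cdot> x)" using xW vW by (simp add: z_def inv_mult)
  ultimately show ?thesis using xW vW by (simp add: length_inv)
qed

end


section \<open>Standard expressions\<close>

abbreviation (input) "vlen \<equiv> \<lambda>(a, N). len (bh_v \<Gamma> a N)"

lemma bh_prod_Cons: "bh_prod \<Gamma> ((a, I) # e) = bh_v \<Gamma> a I \<cdot> bh_prod \<Gamma> e"
  by (simp add: bh_prod_def)

lemma bh_path_prod: "bh_path \<Gamma> J I e K \<Longrightarrow> mor (bh_prod \<Gamma> e) I K \<and> K \<in> associates \<Gamma> J"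
proof (induction rule: bh_path.induct)
  case (Nil I)
  then show ?case by (auto simp: bh_prod_def associates_def intro!: mor_one)
next
  case (Cons I a e K)
  then show ?case by (auto simp: bh_prod_Cons bh_hom_iff intro: mor_mult)
qed

lemma bh_prod_append:
  "bh_path \<Gamma> J I e K \<Longrightarrow> bh_path \<Gamma> J K f N \<Longrightarrow> bh_prod \<Gamma> (e @ f) = bh_prod \<Gamma> e \<cdot> bh_prod \<Gamma> f"
proof (induction rule: bh_path.induct)
  case (Nil I)
  then have "bh_prod \<Gamma> f \<in> W" using bh_path_prod mor_in_W by blast
  then show ?case by (simp add: bh_prod_def[of \<Gamma> "[]"])
next
  case (Cons I a e K)
  have "bh_v \<Gamma> a I \<in> W" "bh_prod \<Gamma> e \<in> W" "bh_prod \<Gamma> f \<in> W"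
    using Cons(4,5,7) bh_path_prod mor_in_W bh_hom_iff by blast+
  then show ?case using Cons by (simp add: bh_prod_Cons m_assoc)
qed

lemma bh_path_append: "bh_path \<Gamma> J I e K \<Longrightarrow> bh_path \<Gamma> J K f N \<Longrightarrow> bh_path \<Gamma> J I (e @ f) N"
  by (induction rule: bh_path.induct) (auto intro: bh_path.Cons)

lemma length_bh_prod: "bh_path \<Gamma> J I e K \<Longrightarrow> len (bh_prod \<Gamma> e) \<le> (\<Sum>p\<leftarrow>e. vlen p)"
proof (induction rule: bh_path.induct)
  case (Nil I)
  then show ?case by (simp add: bh_prod_def)
next
  case (Cons I a e K)
  have "bh_v \<Gamma> a I \<in> W" "bh_prod \<Gamma> e \<in> W"
    using Cons(4,5) bh_path_prod mor_in_W bh_hom_iff by blast+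
  then show ?case using length_mult_le[of "bh_v \<Gamma> a I" "bh_prod \<Gamma> e"] Cons by (simp add: bh_prod_Cons)
qed

lemma bh_v_length: "I \<subseteq> S \<Longrightarrow> a \<in> S - I \<Longrightarrow> finite (parabolic \<Gamma> (component \<Gamma> I a)) \<Longrightarrow> 0 < len (bh_v \<Gamma> a I)"
proof (rule ccontr)
  assume *: "I \<subseteq> S" "a \<in> S - I" "finite (parabolic \<Gamma> (component \<Gamma> I a))" and "\<not> 0 < len (bh_v \<Gamma> a I)"
  then have "bh_v \<Gamma> a I = e1" using length_0[OF bh_v_W[OF *]] by simp
  then show False using bh_v_inv_a[OF *] by simp
qed

lemma length_s_mult:
  assumes "x \<in> W" "i \<in> S" shows "len (s i \<cdot> x) < len x \<longleftrightarrow> nonpos (ginv x \<bullet> \<alpha> i)"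
proof -
  have "ginv (ginv x \<cdot> s i) = s i \<cdot> x" using assms by (simp add: inv_mult)
  then have "len (s i \<cdot> x) = len (ginv x \<cdot> s i)" using length_inv[of "ginv x \<cdot> s i"] assms by simp
  then show ?thesis
    unfolding descent_iff[OF inv_closed[OF assms(1)] assms(2), symmetric]
    using length_mult_s[OF inv_closed[OF assms(1)] assms(2)] length_inv[OF assms(1)] by linarith
qed

text \<open>Recursive form of the definition, on which all inductions over expressions rest: a
  standard expression is a length-additive first factor followed by a standard expression of the
  quotient.\<close>

lemma standard_expression_Cons:
  assumes J: "J \<subseteq> S"
  shows "standard_expression \<Gamma> J I K x ((a, I') # e) \<longleftrightarrow>
    I' = I \<and> I \<in> associates \<Gamma> J \<and> a \<in> S - I \<and> finite (parabolic \<Gamma> (component \<Gamma> I a)) \<and> x \<in> W \<and>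
    len x = len (bh_v \<Gamma> a I) + len (ginv (bh_v \<Gamma> a I) \<cdot> x) \<and>
    standard_expression \<Gamma> J (bh_v_target \<Gamma> a I) K (ginv (bh_v \<Gamma> a I) \<cdot> x) e"
    (is "?l \<longleftrightarrow> ?r")
proof
  let ?v = "bh_v \<Gamma> a I" and ?T = "bh_v_target \<Gamma> a I"
  assume l: ?l
  then have p: "bh_path \<Gamma> J I ((a, I') # e) K" by (simp add: standard_expression_def)
  then have e: "I' = I" "I \<in> associates \<Gamma> J" "a \<in> S - I" "finite (parabolic \<Gamma> (component \<Gamma> I a))"
    "bh_v \<Gamma> a I \<in> bh_hom \<Gamma> J I ?T" and pe: "bh_path \<Gamma> J ?T e K"
    by (auto elim: bh_path.cases)
  have W: "?v \<in> W" "bh_prod \<Gamma> e \<in> W" using e(5) bh_hom_iff bh_path_prod[OF pe] mor_in_W by blast+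
  have x: "x = ?v \<cdot> bh_prod \<Gamma> e" using l e(1) by (simp add: standard_expression_def bh_prod_Cons)
  have len: "len x = len ?v + (\<Sum>p\<leftarrow>e. vlen p)" 
  proof -
    have "len x = (\<Sum>p\<leftarrow>(a, I') # e. vlen p)" using l unfolding standard_expression_def by blast
    then show ?thesis using e(1) by simp
  qed
  \<comment> \<open>The length of a product is at most the sum of the lengths. Equality for the
    whole expression forces equality for the tail.\<close>
  have "len (bh_prod \<Gamma> e) = (\<Sum>p\<leftarrow>e. vlen p)"
    using length_mult_le[OF W] length_bh_prod[OF pe] len x by simp
  moreover have "ginv ?v \<cdot> x = bh_prod \<Gamma> e" using x W by simp
  moreover have "bh_prod \<Gamma> e \<in> bh_hom \<Gamma> J ?T K"
    using bh_path_prod[OF pe] e(5) by (simp add: bh_hom_iff)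
  ultimately show ?r using e W len x pe by (simp add: standard_expression_def)
next
  let ?v = "bh_v \<Gamma> a I" and ?T = "bh_v_target \<Gamma> a I"
  assume r: ?r
  have I: "I \<subseteq> S" using r by (auto simp: associates_def)
  have v: "mor ?v I ?T" using mor_bh_v[OF I] r by blast
  then have vh: "?v \<in> bh_hom \<Gamma> J I ?T" using r mor_associates[OF v _ J] by (simp add: bh_hom_iff)
  have pe: "bh_path \<Gamma> J ?T e K" "ginv ?v \<cdot> x = bh_prod \<Gamma> e"
    "len (ginv ?v \<cdot> x) = (\<Sum>p\<leftarrow>e. vlen p)" using r unfolding standard_expression_def by blast+
  have path: "bh_path \<Gamma> J I ((a, I') # e) K" using bh_path.Cons[OF _ _ _ vh pe(1)] r by simp
  have "?v \<cdot> (ginv ?v \<cdot> x) = x" using mor_in_W[OF v] r by simp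
  then have x: "x = bh_prod \<Gamma> ((a, I') # e)" using r unfolding pe(2) bh_prod_Cons by metis
  have "x \<in> bh_hom \<Gamma> J I K" using bh_path_prod[OF path] r unfolding x bh_hom_iff by blast
  moreover have "len x = (\<Sum>p\<leftarrow>(a, I') # e. vlen p)" using r pe(3) by simp
  ultimately show ?l using path x unfolding standard_expression_def by blast
qed

lemma standard_expression_append:
  assumes "standard_expression \<Gamma> J I K x e" "standard_expression \<Gamma> J K N y f" "len (x \<cdot> y) = len x + len y"
  shows "standard_expression \<Gamma> J I N (x \<cdot> y) (e @ f)"
  using assms bh_prod_append[of J I e K f N] bh_path_append[of J I e K f N]
  by (auto simp: standard_expression_def bh_hom_iff intro: mor_mult)

lemma standard_expression_step:
  assumes J: "J \<subseteq> S" and I: "I \<in> associates \<Gamma> J" and a: "a \<in> S - I" and x: "mor x I K"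
    and neg: "nonpos (ginv x \<bullet> \<alpha> a)"
  shows "finite (parabolic \<Gamma> (component \<Gamma> I a))" (is ?A)
    and "mor (ginv (bh_v \<Gamma> a I) \<cdot> x) (bh_v_target \<Gamma> a I) K" (is ?B)
    and "bh_v_target \<Gamma> a I \<in> associates \<Gamma> J" (is ?C)
    and "len (ginv (bh_v \<Gamma> a I) \<cdot> x) < len x" (is ?D)
    and "standard_expression \<Gamma> J (bh_v_target \<Gamma> a I) K (ginv (bh_v \<Gamma> a I) \<cdot> x) e \<Longrightarrow>
      standard_expression \<Gamma> J I K x ((a, I) # e)" (is "_ \<Longrightarrow> ?E")
proof -
  have IS: "I \<subseteq> S" using x by (simp add: mor_def)
  show fin: ?A by (rule finite_component[OF IS a x neg])
  have v: "mor (bh_v \<Gamma> a I) I (bh_v_target \<Gamma> a I)" by (rule mor_bh_v[OF IS a fin])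
  show ?B by (rule mor_mult[OF mor_inv[OF v] x])
  show ?C by (rule mor_associates[OF v I J])
  have len: "len x = len (bh_v \<Gamma> a I) + len (ginv (bh_v \<Gamma> a I) \<cdot> x)" by (rule bh_v_prefix[OF IS a x neg])
  then show ?D using bh_v_length[OF IS a fin] by simp
  show "standard_expression \<Gamma> J (bh_v_target \<Gamma> a I) K (ginv (bh_v \<Gamma> a I) \<cdot> x) e \<Longrightarrow> ?E"
    using standard_expression_Cons[OF J] I a fin len mor_in_W[OF x] by blast
qed

lemma standard_expression_ex:
  assumes J: "J \<subseteq> S"
  shows "I \<in> associates \<Gamma> J \<Longrightarrow> mor x I K \<Longrightarrow> \<exists>e. standard_expression \<Gamma> J I K x e"
proof (induction "len x" arbitrary: x I rule: less_induct)
  case less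
  have x: "x \<in> W" using mor_in_W[OF less(3)] .
  show ?case
  proof (cases "x = e1")
    case True
    then have "\<alpha> ` I = \<alpha> ` K" using less(3) by (simp add: mor_def)
    then have "I = K" using simple_inj by (metis inj_image_eq_iff injI)
    \<comment> \<open>The empty expression must start and end at the same object, hence the detour
      through \<open>I = K\<close>.\<close>
    then have "standard_expression \<Gamma> J I K x []"
      using True less by (auto simp: standard_expression_def bh_hom_iff bh_prod_def intro: bh_path.Nil)
    then show ?thesis by blast
  next
    case False
    then have "ginv x \<noteq> e1" using x by (metis inv_one inv_inv)
    then obtain a where a: "a \<in> S" "len (ginv x \<cdot> s a) < len (ginv x)" using descent_ex x by (metis inv_closed)
    then have neg: "nonpos (ginv x \<bullet> \<alpha> a)" using descent_nonpos x by blast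
    \<comment> \<open>A morphism sends the simple roots of \<open>I\<close> to simple roots, so no
      left descent lies in \<open>I\<close>.\<close>
    have "a \<notin> I"
    proof
      assume "a \<in> I"
      then obtain k where "ginv x \<bullet> \<alpha> a = \<alpha> k" using mor_E[OF less(3)] by blast
      then show False using neg by simp
    qed
    then have a': "a \<in> S - I" using a by blast
    note step = standard_expression_step[OF J less(2) a' less(3) neg]
    obtain e where "standard_expression \<Gamma> J (bh_v_target \<Gamma> a I) K (ginv (bh_v \<Gamma> a I) \<cdot> x) e"
      using less(1)[OF step(4,3,2)] by blast
    then show ?thesis using step(5) by blast
  qed
qed

text \<open>\<open>a\<close> is a left descent of the first factor, and length-additivity passes
  this on to the whole product.\<close>

lemma standard_expression_descent:
  assumes J: "J \<subseteq> S" and e: "standard_expression \<Gamma> J I K x ((a, I) # e)"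
  shows "nonpos (ginv x \<bullet> \<alpha> a)"
proof -
  let ?v = "bh_v \<Gamma> a I"
  note E = e[unfolded standard_expression_Cons[OF J]]
  have I: "I \<subseteq> S" using E by (auto simp: associates_def)
  have W: "?v \<in> W" "x \<in> W" "a \<in> S" using bh_v_W[OF I, of a] E by auto
  have "nonpos (ginv ?v \<bullet> \<alpha> a)" using bh_v_inv_a[OF I] E by blast
  then have "len (s a \<cdot> ?v) < len ?v" using length_s_mult W by blast
  moreover have "len (s a \<cdot> ?v \<cdot> (ginv ?v \<cdot> x)) \<le> len (s a \<cdot> ?v) + len (ginv ?v \<cdot> x)"
    using W by (intro length_mult_le) auto
  moreover have "s a \<cdot> ?v \<cdot> (ginv ?v \<cdot> x) = s a \<cdot> x" using W by (simp add: m_assoc)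
  moreover have "len x = len ?v + len (ginv ?v \<cdot> x)" using E by blast
  ultimately have "len (s a \<cdot> x) < len x" by simp
  then show ?thesis using length_s_mult W by blast
qed


section \<open>Atomic braid relations\<close>

text \<open>Two elements with the defining property have the same signs on all roots of
  \<open>M\<close>, so \<open>g \<cdot> ginv h\<close> keeps the simple roots of \<open>M\<close>
  positive and is trivial. This justifies the definite description in \<open>bh_vv\<close>.\<close>

lemma bh_vv_eq:
  assumes I: "I \<subseteq> S" "a \<in> S" "b \<in> S" and u: "u \<in> parabolic \<Gamma> (insert a (insert b I))"
    and neg: "\<And>\<beta>. \<beta> \<in> pos_roots \<Gamma> (insert a (insert b I)) - pos_roots \<Gamma> I \<Longrightarrow> nonpos (u \<bullet> \<beta>)"
    and pos: "\<And>\<beta>. \<beta> \<in> pos_roots \<Gamma> I \<Longrightarrow> nonneg (u \<bullet> \<beta>)"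
  shows "bh_vv \<Gamma> a b I = ginv u"
proof -
  define M where "M = insert a (insert b I)"
  have M: "M \<subseteq> S" "I \<subseteq> M" using I by (auto simp: M_def)
  let ?Q = "\<lambda>u. u \<in> parabolic \<Gamma> M \<and> act \<Gamma> u ` (pos_roots \<Gamma> M - pos_roots \<Gamma> I) \<subseteq> neg_roots \<Gamma> M \<and>
        act \<Gamma> u ` pos_roots \<Gamma> I \<subseteq> pos_roots \<Gamma> M"
  have IM: "pos_roots \<Gamma> I \<subseteq> roots \<Gamma> M"
    using supp_mono[OF _ M(2)] by (auto simp: pos_roots_def roots_iff[OF M(1)] roots_iff[OF I(1)])
  have pM: "\<beta> \<in> pos_roots \<Gamma> M \<longleftrightarrow> \<beta> \<in> roots \<Gamma> M \<and> nonneg \<beta>" "\<beta> \<in> neg_roots \<Gamma> M \<longleftrightarrow> \<beta> \<in> roots \<Gamma> M \<and> nonpos \<beta>" for \<beta>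
    by (auto simp: pos_roots_def neg_roots_def nonneg_def nonpos_def)
  have Q: "?Q u"
  proof (intro conjI image_subsetI)
    fix \<beta> assume "\<beta> \<in> pos_roots \<Gamma> M - pos_roots \<Gamma> I"
    then show "u \<bullet> \<beta> \<in> neg_roots \<Gamma> M"
      using neg roots_act[OF M(1) u[folded M_def]] by (auto simp: pM M_def[symmetric])
  next
    fix \<beta> assume "\<beta> \<in> pos_roots \<Gamma> I"
    then show "u \<bullet> \<beta> \<in> pos_roots \<Gamma> M"
      using pos roots_act[OF M(1) u[folded M_def]] IM by (auto simp: pM)
  qed (use u in \<open>simp add: M_def\<close>)
  have Qneg: "g \<bullet> \<beta> \<in> neg_roots \<Gamma> M" if "?Q g" "\<beta> \<in> pos_roots \<Gamma> M" "\<beta> \<notin> pos_roots \<Gamma> I" for g \<beta>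
    by (rule subsetD[OF conjunct1[OF conjunct2[OF that(1)]]]) (use that(2,3) in \<open>intro imageI DiffI\<close>)
  have Qpos: "g \<bullet> \<beta> \<in> pos_roots \<Gamma> M" if "?Q g" "\<beta> \<in> pos_roots \<Gamma> I" for g \<beta>
    by (rule subsetD[OF conjunct2[OF conjunct2[OF that(1)]]]) (use that(2) in \<open>intro imageI\<close>)
  have unique: "g = h" if "?Q g" "?Q h" for g h
  proof -
    have W: "g \<in> W" "h \<in> W" using that parabolic_in_W[OF M(1)] by auto
    have "g \<cdot> ginv h = e1"
    proof (rule parabolic_eq_one[OF M(1)])
      show "g \<cdot> ginv h \<in> parabolic \<Gamma> M"
        using parabolic_mult[OF M(1) _ parabolic_inv[OF M(1)], of g h] that by simp
      fix m assume m: "m \<in> M"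
      define \<gamma> where "\<gamma> = ginv h \<bullet> \<alpha> m"
      have \<gamma>: "\<gamma> \<in> roots \<Gamma> M" "(\<lambda>k. - \<gamma> k) \<in> roots \<Gamma> M"
        using parabolic_root[OF M(1) parabolic_inv[OF M(1)] m, of h] that is_root_minus
        by (auto simp: \<gamma>_def roots_iff[OF M(1)] supp_def)
      have h\<gamma>: "h \<bullet> \<gamma> = \<alpha> m" using W by (simp add: \<gamma>_def)
      have "nonneg \<gamma> \<or> nonpos \<gamma>" using \<gamma>(1) root_cases by (auto simp: roots_iff[OF M(1)])
      then have "nonneg (g \<bullet> \<gamma>)"
      proof
        assume n: "nonneg \<gamma>"
        have "h \<bullet> \<gamma> \<notin> neg_roots \<Gamma> M" using h\<gamma> by (simp add: pM)
        moreover have "\<gamma> \<in> pos_roots \<Gamma> M" using n \<gamma>(1) pM(1) by simp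
        ultimately have "\<gamma> \<in> pos_roots \<Gamma> I"
          using Qneg[OF that(2)] by blast
        then have "g \<bullet> \<gamma> \<in> pos_roots \<Gamma> M" by (rule Qpos[OF that(1)])
        then show ?thesis by (simp add: pM(1))
      next
        assume n: "nonpos \<gamma>"
        have "h \<bullet> (\<lambda>k. - \<gamma> k) \<notin> pos_roots \<Gamma> M" using h\<gamma> W by (simp add: pM act_minus)
        then have "(\<lambda>k. - \<gamma> k) \<notin> pos_roots \<Gamma> I"
          using Qpos[OF that(2)] by blast
        moreover have "(\<lambda>k. - \<gamma> k) \<in> pos_roots \<Gamma> M" using n \<gamma>(2) pM(1) by simp
        ultimately have "g \<bullet> (\<lambda>k. - \<gamma> k) \<in> neg_roots \<Gamma> M"
          using Qneg[OF that(1)] by blast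
        then show ?thesis using W by (simp add: act_minus pM(2))
      qed
      then show "nonneg ((g \<cdot> ginv h) \<bullet> \<alpha> m)" using W by (simp add: act_mult \<gamma>_def)
    qed
    then have "g \<cdot> ginv h \<cdot> h = h" using W by simp
    then show ?thesis using W by simp
  qed
  have "(THE u. ?Q u) = u" by (rule the_equality[of ?Q, OF Q]) (rule unique[OF _ Q])
  then show ?thesis by (simp add: bh_vv_def M_def)
qed

text \<open>Here \<open>w\<^sup>-\<^sup>1 = y u\<close> with \<open>u \<in> W\<^bsub>I+a+b\<^esub>\<close> and \<open>y\<close> of minimal length in its coset; then
  \<open>u\<^sup>-\<^sup>1 = v\<^bsub>a,b,I\<^esub>\<close> is a length-additive left factor of \<open>w\<close>.\<close>

lemma common_multiple:
  assumes J: "J \<subseteq> S" and I: "I \<in> associates \<Gamma> J" and ab: "a \<in> S - I" "b \<in> S - I" "a \<noteq> b"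
    and w: "mor w I K" and neg: "nonpos (ginv w \<bullet> \<alpha> a)" "nonpos (ginv w \<bullet> \<alpha> b)"
  obtains f f' g where "standard_expression \<Gamma> J I K w ((a, I) # f @ g)"
    "standard_expression \<Gamma> J I K w ((b, I) # f' @ g)"
    "atomic_braid_relation \<Gamma> J ((a, I) # f) ((b, I) # f')"
proof -
  define M where "M = insert a (insert b I)"
  have IS: "I \<subseteq> S" and K: "K \<subseteq> S" and wW: "w \<in> W" using w by (auto simp: mor_def)
  have M: "M \<subseteq> S" "I \<subseteq> M" using IS ab by (auto simp: M_def)
  obtain y u where y: "y \<in> W" "u \<in> parabolic \<Gamma> M" "ginv w = y \<cdot> u" "\<And>m. m \<in> M \<Longrightarrow> nonneg (y \<bullet> \<alpha> m)"
    using coset_decomposition[OF M(1)] wW by (metis inv_closed)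
  have u: "u \<in> W" using parabolic_in_W[OF M(1) y(2)] .
  have act: "ginv w \<bullet> \<beta> = y \<bullet> u \<bullet> \<beta>" for \<beta> using y u by (simp add: act_mult)
  \<comment> \<open>The representative \<open>y\<close> does not affect signs on roots supported on
    \<open>M\<close>, so there \<open>u\<close> has the sign pattern of \<open>ginv w\<close>, which
    is the one that characterizes the inverse of \<open>bh_vv\<close>.\<close>
  have sgn: "nonneg (u \<bullet> \<beta>) \<longleftrightarrow> nonneg (ginv w \<bullet> \<beta>)" "nonpos (u \<bullet> \<beta>) \<longleftrightarrow> nonpos (ginv w \<bullet> \<beta>)"
    if "is_root \<beta>" "supp M \<beta>" for \<beta>
    unfolding act using nonneg_act_iff[OF M(1) y(1,4), of "u \<bullet> \<beta>"] that
      supp_act[OF M(1) y(2)] is_root_act[OF _ u] by blast+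
  have wneg: "nonpos (ginv w \<bullet> \<beta>)" if "is_root \<beta>" "supp M \<beta>" "nonneg \<beta>" "\<not> supp I \<beta>" for \<beta>
    using mor_nonpos[OF w M(2,1) _ that] neg by (auto simp: M_def)
  have vv: "bh_vv \<Gamma> a b I = ginv u"
  proof (rule bh_vv_eq[OF IS])
    show "u \<in> parabolic \<Gamma> (insert a (insert b I))" using y(2) by (simp add: M_def)
    fix \<beta> assume "\<beta> \<in> pos_roots \<Gamma> (insert a (insert b I)) - pos_roots \<Gamma> I"
    then have "is_root \<beta>" "supp M \<beta>" "nonneg \<beta>" "\<not> supp I \<beta>"
      by (auto simp: pos_roots_def roots_iff[OF IS] roots_iff[OF M(1)] M_def[symmetric] nonneg_def)
    then show "nonpos (u \<bullet> \<beta>)" using sgn wneg by blast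
  next
    fix \<beta> assume "\<beta> \<in> pos_roots \<Gamma> I"
    then have b: "is_root \<beta>" "supp I \<beta>" "nonneg \<beta>"
      by (auto simp: pos_roots_def roots_iff[OF IS] nonneg_def)
    then show "nonneg (u \<bullet> \<beta>)" using sgn(1) mor_nonneg[OF w] supp_mono[OF b(2) M(2)] by blast
  qed (use ab in auto)
  \<comment> \<open>Up to sign, each of these roots is an inversion of
    \<open>ginv w\<close>.\<close>
  have fin: "finite (roots \<Gamma> M - roots \<Gamma> I)"
  proof -
    let ?N = "{\<beta>. is_root \<beta> \<and> nonneg \<beta> \<and> nonpos (ginv w \<bullet> \<beta>)}"
    have "roots \<Gamma> M - roots \<Gamma> I \<subseteq> ?N \<union> (\<lambda>\<beta> k. - \<beta> k) ` ?N"
    proof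
      fix \<beta> assume "\<beta> \<in> roots \<Gamma> M - roots \<Gamma> I"
      then have b: "is_root \<beta>" "supp M \<beta>" "\<not> supp I \<beta>" using roots_iff IS M(1) by auto
      show "\<beta> \<in> ?N \<union> (\<lambda>\<beta> k. - \<beta> k) ` ?N"
      proof (cases "nonneg \<beta>")
        case True
        then show ?thesis using b wneg by blast
      next
        case False
        then have n: "nonneg (\<lambda>k. - \<beta> k)" using root_cases b(1) by auto
        have "supp M (\<lambda>k. - \<beta> k)" "\<not> supp I (\<lambda>k. - \<beta> k)" using b by (auto simp: supp_def)
        then have "(\<lambda>k. - \<beta> k) \<in> ?N" using n wneg is_root_minus[OF b(1)] by blast
        then show ?thesis by (intro UnI2 rev_image_eqI[of "\<lambda>k. - \<beta> k"]) auto
      qed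
    qed
    moreover have "finite ?N" using finite_inversions wW by blast
    ultimately show ?thesis using finite_subset by blast
  qed
  \<comment> \<open>\<open>y\<close> sends \<open>u \<bullet> \<alpha> i\<close> to a simple root,
    so it was simple already. Hence \<open>ginv u\<close> is a morphism from \<open>I\<close> to
    some \<open>I'\<close>, and the factorization of \<open>w\<close> takes place in the
    groupoid.\<close>
  have "\<exists>m\<in>M. u \<bullet> \<alpha> i = \<alpha> m" if i: "i \<in> I" for i
  proof -
    obtain k where "ginv w \<bullet> \<alpha> i = \<alpha> k" using mor_E[OF w i] .
    then have "y \<bullet> u \<bullet> \<alpha> i = \<alpha> k" using act by simp
    then show ?thesis
      using simple_preimage[OF M(1) y(1,4), of "u \<bullet> \<alpha> i" k] parabolic_root[OF M(1) y(2), of i] i M(2) by blast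
  qed
  then obtain \<tau> where \<tau>: "\<And>i. i \<in> I \<Longrightarrow> \<tau> i \<in> M \<and> u \<bullet> \<alpha> i = \<alpha> (\<tau> i)" by metis
  define I' where "I' = \<tau> ` I"
  have "mor u I' I" using \<tau> u IS M(1) by (auto simp: mor_def I'_def image_image)
  then have v: "mor (ginv u) I I'" using mor_inv by blast
  have I': "I' \<in> associates \<Gamma> J" by (rule mor_associates[OF v I J])
  have "mor (ginv y) I' K"
  proof -
    have "mor (u \<cdot> w) I' K" using mor_mult[OF \<open>mor u I' I\<close> w] .
    moreover have "u \<cdot> w = ginv y"
    proof -
      have "w = ginv (y \<cdot> u)" using y(3) wW by (metis inv_inv)
      then show ?thesis using y(1) u by (simp add: inv_mult m_assoc[symmetric])
    qed
    ultimately show ?thesis by simp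
  qed
  \<comment> \<open>One expression of the remaining factor is chosen once and serves as the common
    tail, so the two expressions differ only in the atomic part.\<close>
  then obtain g where g: "standard_expression \<Gamma> J I' K (ginv y) g"
    using standard_expression_ex[OF J I'] by blast
  have w_eq: "w = ginv u \<cdot> ginv y" using y(1,3) u wW by (metis inv_inv inv_mult)
  have len: "len (ginv u \<cdot> ginv y) = len (ginv u) + len (ginv y)"
    using length_add[OF M(1) y(1,4,2)] y u by (simp add: inv_mult[symmetric] length_inv)
  \<comment> \<open>By \<open>sgn\<close>, the left descents \<open>a\<close> and \<open>b\<close>
    of \<open>w\<close> are left descents of \<open>ginv u\<close>, so either may come
    first.\<close>
  have start: "\<exists>f. standard_expression \<Gamma> J I I' (ginv u) ((c, I) # f)" if c: "c \<in> {a, b}" for c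
  proof -
    have cI: "c \<in> S - I" "c \<in> M" using c ab by (auto simp: M_def)
    have "nonpos (ginv w \<bullet> \<alpha> c)" using c neg by auto
    then have "nonpos (ginv (ginv u) \<bullet> \<alpha> c)"
      using sgn(2)[of "\<alpha> c"] cI is_root_simple u by simp
    note step = standard_expression_step[OF J I cI(1) v this]
    show ?thesis using standard_expression_ex[OF J step(3,2)] step(5) by blast
  qed
  obtain f where f: "standard_expression \<Gamma> J I I' (ginv u) ((a, I) # f)" using start by blast
  obtain f' where f': "standard_expression \<Gamma> J I I' (ginv u) ((b, I) # f')" using start by blast
  have "atomic_braid_relation \<Gamma> J ((a, I) # f) ((b, I) # f')"
    unfolding atomic_braid_relation_def using I ab fin f f' vv unfolding M_def by metis
  moreover have "standard_expression \<Gamma> J I K w ((a, I) # f @ g)"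
    "standard_expression \<Gamma> J I K w ((b, I) # f' @ g)"
    using standard_expression_append[OF f g len] standard_expression_append[OF f' g len] w_eq by simp_all
  ultimately show thesis using that by blast
qed

lemma atomic_braid_step_Cons:
  "(atomic_braid_step \<Gamma> J)\<^sup>*\<^sup>* e e' \<Longrightarrow> (atomic_braid_step \<Gamma> J)\<^sup>*\<^sup>* (p # e) (p # e')"
proof (induction rule: rtranclp_induct)
  case (step f g)
  have "atomic_braid_step \<Gamma> J (p # f) (p # g)"
    using step(2) unfolding atomic_braid_step_def by (metis append_Cons)
  then show ?case using step(3) by simp
qed simp

lemma standard_expressions_connected:
  assumes J: "J \<subseteq> S"
  shows "standard_expression \<Gamma> J I K w e \<Longrightarrow> standard_expression \<Gamma> J I K w e' \<Longrightarrow>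
    (atomic_braid_step \<Gamma> J)\<^sup>*\<^sup>* e e'"
proof (induction "len w" arbitrary: w I e e' rule: less_induct)
  case less
  \<comment> \<open>Each factor has positive length: only the identity has the empty standard
    expression, and the quotient by a first factor is strictly shorter.\<close>
  have pos: "0 < len w" if "standard_expression \<Gamma> J I K w (p # f)" for p f
  proof -
    obtain a I' where p: "p = (a, I')" by (cases p)
    note E = that[unfolded p standard_expression_Cons[OF J]]
    then have "I \<subseteq> S" by (auto simp: associates_def)
    then show ?thesis using bh_v_length[of I a] E by linarith
  qed
  \<comment> \<open>A common first factor is cancelled, the induction hypothesis connects the tails,
    and the factor is put back.\<close>
  have same: "(atomic_braid_step \<Gamma> J)\<^sup>*\<^sup>* ((a, I) # f) ((a, I) # f')"
    if e: "standard_expression \<Gamma> J I K w ((a, I) # f)" "standard_expression \<Gamma> J I K w ((a, I) # f')" for a f f'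
  proof -
    note E = e[unfolded standard_expression_Cons[OF J]]
    have "I \<subseteq> S" using E by (auto simp: associates_def)
    then have "len (ginv (bh_v \<Gamma> a I) \<cdot> w) < len w" using bh_v_length[of I a] E by linarith
    then show ?thesis using less(1) E atomic_braid_step_Cons by blast
  qed
  show ?case
  proof (cases "e = [] \<or> e' = []")
    case True
    have "len w = 0" if "standard_expression \<Gamma> J I K w []"
      using that unfolding standard_expression_def by (metis list.map(1) sum_list.Nil)
    then have "e = [] \<and> e' = []" using True less(2,3) pos by (metis less_irrefl neq_Nil_conv)
    then show ?thesis by simp
  next
    case False
    then obtain a I1 f b I2 f' where ee: "e = (a, I1) # f" "e' = (b, I2) # f'"
      by (metis neq_Nil_conv surj_pair)
    then have I12: "I1 = I" "I2 = I" using less(2,3) standard_expression_Cons[OF J] by auto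
    note e = less(2)[unfolded ee I12] and e' = less(3)[unfolded ee I12]
    show ?thesis
    proof (cases "a = b")
      case True
      then show ?thesis using same e e' ee I12 by blast
    next
      case False
      note E = e[unfolded standard_expression_Cons[OF J]] e'[unfolded standard_expression_Cons[OF J]]
      have I: "I \<in> associates \<Gamma> J" "a \<in> S - I" "b \<in> S - I" using E by auto
      have w: "mor w I K" using e bh_hom_iff unfolding standard_expression_def by blast
      obtain h h' g where h: "standard_expression \<Gamma> J I K w ((a, I) # h @ g)"
        "standard_expression \<Gamma> J I K w ((b, I) # h' @ g)"
        "atomic_braid_relation \<Gamma> J ((a, I) # h) ((b, I) # h')"
        using common_multiple[OF J I False w standard_expression_descent[OF J e] standard_expression_descent[OF J e']] .
      \<comment> \<open>This single step joins an expression that begins like \<open>e\<close> to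
        one that begins like \<open>e'\<close>; the two ends are covered by
        \<open>same\<close>.\<close>
      have "atomic_braid_step \<Gamma> J ((a, I) # h @ g) ((b, I) # h' @ g)"
        unfolding atomic_braid_step_def using h(3) by (metis append_Cons append_Nil)
      then show ?thesis
        using same[OF e h(1)] same[OF h(2) e'] unfolding ee I12 by (meson rtranclp.rtrancl_into_rtrancl rtranclp_trans)
    qed
  qed
qed

end

theorem theorem1p4:
  fixes \<Gamma> :: "'a coxeter_diagram" and J I K :: "'a set"
    and w :: "'a list set" and e e' :: "('a \<times> 'a set) list"
  assumes "is_coxeter_diagram \<Gamma>"
    and "J \<subseteq> verts \<Gamma>"
    and "I \<in> associates \<Gamma> J" and "K \<in> associates \<Gamma> J"
    and "w \<in> bh_hom \<Gamma> J I K"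
    and "standard_expression \<Gamma> J I K w e"
    and "standard_expression \<Gamma> J I K w e'"
  shows "(atomic_braid_step \<Gamma> J)\<^sup>*\<^sup>* e e'"
proof -
  interpret coxeter \<Gamma> by unfold_locales (rule assms(1))
  show ?thesis using standard_expressions_connected[OF assms(2,6,7)] .
qed

end
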